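(* Let $k$ be a number field of class number $1$ with ring of integers $R$, let $a,b\in R$ be such that $ab$ is square-free, and let $A=\left(\frac{a,b}{k}\right)$. Suppose in addition that $\Delta(A)$ divides $abR$. For each prime ideal $\mathcal{P}_i$ of $R$ with $\mathcal{P}_i\notin Ram_f(A)$ let $\pi_i\in R$ be a generator, $\pi_iR=\mathcal{P}_i$, and set $$r=\begin{cases}1 & \text{if }\Delta(A)=abR,\\ \displaystyle\prod_{\mathcal{P}_i\mid abR,\ \mathcal{P}_i\nmid\Delta(A)}\pi_i & \text{if }\Delta(A)\neq abR.\end{cases}$$ Let $\mathcal{O}'=R[1,i,j,ij]$. If $\mathcal{O}=\mathcal{O}'[\beta]$ is a maximal order of $A$ for some $\beta\in A$, then $$\beta\in\frac{1}{2r}\mathcal{O}'.$$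
   Context: $A=\left(\frac{a,b}{k}\right)$ denotes the quaternion algebra over $k$ with basis $1,i,j,ij$ and relations $i^2=a$, $j^2=b$, $ij=-ji$. $Ram_f(A)$ is the set of prime ideals of $R$ at which $A$ is ramified, and $\Delta(A)$ is the product of these prime ideals. $R[1,i,j,ij]$ denotes the $R$-submodule of $A$ spanned by $1,i,j,ij$ (an order of $A$), and $\mathcal{O}'[\beta]$ denotes the subring of $A$ generated by $\mathcal{O}'$ and $\beta$. An order of $A$ is a complete $R$-lattice in $A$ (finitely generated $R$-submodule spanning $A$ over $k$) that is also a ring with $1$; it is maximal if it is maximal with respect to inclusion. $ab$ is square-free if the ideal $abR$ is not divisible by the square of a prime ideal of $R$. *)

theory Defs
  imports "HOL-Algebra.Algebra" "HOL-Algebra.Algebraic_Closure_Type"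
begin

text \<open>
  The number field \<open>k\<close> is a type \<open>'k\<close> of class \<open>field_char_0\<close>, and \<open>ring_of_type_algebra\<close> is
  \<open>k\<close> as a HOL-Algebra ring.  Everything built from \<open>k\<close> is a HOL-Algebra structure.
\<close>

definition number_field :: "'k::field_char_0 itself \<Rightarrow> bool" where
  "number_field _ \<longleftrightarrow>
     (\<exists>B. finite_dimensional_vector_space (\<lambda>q (x::'k). of_rat q * x) B)"

definition ring_of_integers :: "'k::field_char_0 ring" where
  "ring_of_integers = ring_of_type_algebra \<lparr>carrier := {x. algebraic_int x}\<rparr>"

definition nonzero_ideals :: "('a, 'm) ring_scheme \<Rightarrow> 'a set set" where
  "nonzero_ideals R = {I. ideal I R \<and> I \<noteq> {\<zero>\<^bsub>R\<^esub>}}"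

definition ideal_class_rel :: "('a, 'm) ring_scheme \<Rightarrow> ('a set \<times> 'a set) set" where
  "ideal_class_rel R = {(I, J). I \<in> nonzero_ideals R \<and> J \<in> nonzero_ideals R \<and>
     (\<exists>x \<in> carrier R - {\<zero>\<^bsub>R\<^esub>}. \<exists>y \<in> carrier R - {\<zero>\<^bsub>R\<^esub>}. x <#\<^bsub>R\<^esub> I = y <#\<^bsub>R\<^esub> J)}"

text \<open>The class group as integral ideals \<open>I \<noteq> 0\<close> modulo \<open>I \<sim> J \<longleftrightarrow> xI = yJ\<close> for some nonzero \<open>x\<close>, \<open>y\<close>.\<close>

definition class_number :: "('a, 'm) ring_scheme \<Rightarrow> nat" where
  "class_number R = card (nonzero_ideals R // ideal_class_rel R)"

text \<open>
  Prime ideals are taken to be nonzero, as usual for the primes of a number field.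
\<close>

definition prime_ideals :: "('a, 'm) ring_scheme \<Rightarrow> 'a set set" where
  "prime_ideals R = {P. primeideal P R \<and> P \<noteq> {\<zero>\<^bsub>R\<^esub>}}"

text \<open>Divisibility, products and powers of ideals are those of the monoid \<open>ideals_set R\<close>.\<close>

definition squarefree_elt :: "('a, 'm) ring_scheme \<Rightarrow> 'a \<Rightarrow> bool" where
  "squarefree_elt R x \<longleftrightarrow>
     (\<forall>P \<in> prime_ideals R. \<not> (P [^]\<^bsub>ideals_set R\<^esub> (2::nat)) divides\<^bsub>ideals_set R\<^esub> PIdl\<^bsub>R\<^esub> x)"

text \<open>
  The quadruple \<open>(x\<^sub>0, x\<^sub>1, x\<^sub>2, x\<^sub>3)\<close> stands for \<open>x\<^sub>0 + x\<^sub>1 i + x\<^sub>2 j + x\<^sub>3 ij\<close>; the product is the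
  bilinear one determined by \<open>i\<^sup>2 = a\<close>, \<open>j\<^sup>2 = b\<close>, \<open>ij = -ji\<close>.  The base \<open>K\<close> is arbitrary, so that
  \<open>quaternion_algebra L a b\<close> also serves as the scalar extension of \<open>quaternion_algebra K a b\<close>
  to an extension \<open>L\<close> of \<open>K\<close>.
\<close>

type_synonym 'a quad = "'a \<times> 'a \<times> 'a \<times> 'a"

fun quat_mult :: "('a, 'm) ring_scheme \<Rightarrow> 'a \<Rightarrow> 'a \<Rightarrow> 'a quad \<Rightarrow> 'a quad \<Rightarrow> 'a quad" where
  "quat_mult K a b (x0, x1, x2, x3) (y0, y1, y2, y3) =
     (((x0 \<otimes>\<^bsub>K\<^esub> y0 \<oplus>\<^bsub>K\<^esub> a \<otimes>\<^bsub>K\<^esub> (x1 \<otimes>\<^bsub>K\<^esub> y1)) \<oplus>\<^bsub>K\<^esub> b \<otimes>\<^bsub>K\<^esub> (x2 \<otimes>\<^bsub>K\<^esub> y2)) \<ominus>\<^bsub>K\<^esub> (a \<otimes>\<^bsub>K\<^esub> b) \<otimes>\<^bsub>K\<^esub> (x3 \<otimes>\<^bsub>K\<^esub> y3),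
      (x0 \<otimes>\<^bsub>K\<^esub> y1 \<oplus>\<^bsub>K\<^esub> x1 \<otimes>\<^bsub>K\<^esub> y0) \<oplus>\<^bsub>K\<^esub> b \<otimes>\<^bsub>K\<^esub> (x3 \<otimes>\<^bsub>K\<^esub> y2 \<ominus>\<^bsub>K\<^esub> x2 \<otimes>\<^bsub>K\<^esub> y3),
      (x0 \<otimes>\<^bsub>K\<^esub> y2 \<oplus>\<^bsub>K\<^esub> x2 \<otimes>\<^bsub>K\<^esub> y0) \<oplus>\<^bsub>K\<^esub> a \<otimes>\<^bsub>K\<^esub> (x1 \<otimes>\<^bsub>K\<^esub> y3 \<ominus>\<^bsub>K\<^esub> x3 \<otimes>\<^bsub>K\<^esub> y1),
      (x0 \<otimes>\<^bsub>K\<^esub> y3 \<oplus>\<^bsub>K\<^esub> x3 \<otimes>\<^bsub>K\<^esub> y0) \<oplus>\<^bsub>K\<^esub> (x1 \<otimes>\<^bsub>K\<^esub> y2 \<ominus>\<^bsub>K\<^esub> x2 \<otimes>\<^bsub>K\<^esub> y1))"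

fun quat_add :: "('a, 'm) ring_scheme \<Rightarrow> 'a quad \<Rightarrow> 'a quad \<Rightarrow> 'a quad" where
  "quat_add K (x0, x1, x2, x3) (y0, y1, y2, y3) =
     (x0 \<oplus>\<^bsub>K\<^esub> y0, x1 \<oplus>\<^bsub>K\<^esub> y1, x2 \<oplus>\<^bsub>K\<^esub> y2, x3 \<oplus>\<^bsub>K\<^esub> y3)"

definition quat_scalar :: "('a, 'm) ring_scheme \<Rightarrow> 'a \<Rightarrow> 'a quad" where
  "quat_scalar K x = (x, \<zero>\<^bsub>K\<^esub>, \<zero>\<^bsub>K\<^esub>, \<zero>\<^bsub>K\<^esub>)"

definition quat_i :: "('a, 'm) ring_scheme \<Rightarrow> 'a quad" where
  "quat_i K = (\<zero>\<^bsub>K\<^esub>, \<one>\<^bsub>K\<^esub>, \<zero>\<^bsub>K\<^esub>, \<zero>\<^bsub>K\<^esub>)"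

definition quat_j :: "('a, 'm) ring_scheme \<Rightarrow> 'a quad" where
  "quat_j K = (\<zero>\<^bsub>K\<^esub>, \<zero>\<^bsub>K\<^esub>, \<one>\<^bsub>K\<^esub>, \<zero>\<^bsub>K\<^esub>)"

definition quaternion_algebra :: "('a, 'm) ring_scheme \<Rightarrow> 'a \<Rightarrow> 'a \<Rightarrow> 'a quad ring" where
  "quaternion_algebra K a b =
     \<lparr>carrier = carrier K \<times> carrier K \<times> carrier K \<times> carrier K,
      monoid.mult = quat_mult K a b, one = quat_scalar K \<one>\<^bsub>K\<^esub>,
      ring.zero = quat_scalar K \<zero>\<^bsub>K\<^esub>, add = quat_add K\<rparr>"

text \<open>The next facts confirm the multiplication table and that \<open>quaternion_algebra\<close> is a ring.\<close>

lemma (in cring) quat_relations: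
  assumes "a \<in> carrier R" "b \<in> carrier R"
  defines "A \<equiv> quaternion_algebra R a b"
  shows "quat_i R \<otimes>\<^bsub>A\<^esub> quat_i R = quat_scalar R a"
    and "quat_j R \<otimes>\<^bsub>A\<^esub> quat_j R = quat_scalar R b"
    and "quat_i R \<otimes>\<^bsub>A\<^esub> quat_j R = (\<zero>, \<zero>, \<zero>, \<one>)"
    and "quat_j R \<otimes>\<^bsub>A\<^esub> quat_i R = (\<zero>, \<zero>, \<zero>, \<ominus> \<one>)"
  using assms(1,2)
  by (simp_all add: A_def quaternion_algebra_def quat_i_def quat_j_def quat_scalar_def a_minus_def)

lemma (in cring) quaternion_algebra_ring:
  assumes ab: "a \<in> carrier R" "b \<in> carrier R"
  shows "ring (quaternion_algebra R a b)"
proof -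
  let ?A = "quaternion_algebra R a b"
  note defs = quaternion_algebra_def quat_scalar_def
  note ring_norm = a_minus_def l_distr r_distr l_minus r_minus minus_add m_ac a_ac
  have inv: "\<exists>y\<in>carrier ?A. y \<oplus>\<^bsub>?A\<^esub> x = \<zero>\<^bsub>?A\<^esub>" if "x \<in> carrier ?A" for x
  proof -
    obtain x0 x1 x2 x3 where x: "x = (x0, x1, x2, x3)" by (cases x)
    show ?thesis
      using that unfolding x
      by (intro bexI[of _ "(\<ominus> x0, \<ominus> x1, \<ominus> x2, \<ominus> x3)"]) (auto simp: defs l_neg)
  qed
  have "abelian_group ?A"
    by (rule abelian_groupI) (auto simp: defs a_ac intro: inv[unfolded defs, simplified])
  moreover have "monoid ?A"
    by (rule monoidI) (use ab in \<open>auto simp: defs ring_norm\<close>)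
  moreover have "(x \<oplus>\<^bsub>?A\<^esub> y) \<otimes>\<^bsub>?A\<^esub> z = x \<otimes>\<^bsub>?A\<^esub> z \<oplus>\<^bsub>?A\<^esub> y \<otimes>\<^bsub>?A\<^esub> z"
      "z \<otimes>\<^bsub>?A\<^esub> (x \<oplus>\<^bsub>?A\<^esub> y) = z \<otimes>\<^bsub>?A\<^esub> x \<oplus>\<^bsub>?A\<^esub> z \<otimes>\<^bsub>?A\<^esub> y"
    if "x \<in> carrier ?A" "y \<in> carrier ?A" "z \<in> carrier ?A" for x y z
    using that ab by (auto simp: defs ring_norm)
  ultimately show ?thesis by (intro ringI) auto
qed

text \<open>
  For a prime \<open>P\<close> of \<open>k\<close>, \<open>padic_nhd P n = P\<^sup>n R\<^sub>P = {x. v\<^sub>P x \<ge> n}\<close>; these sets are a neighbourhood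
  basis of 0 in the \<open>P\<close>-adic topology.  The completion \<open>k\<^sub>P\<close> is the ring of \<open>P\<close>-adic Cauchy
  sequences modulo null sequences.
\<close>

definition padic_nhd :: "'k::field_char_0 set \<Rightarrow> nat \<Rightarrow> 'k set" where
  "padic_nhd P n = {x. \<exists>u \<in> P [^]\<^bsub>ideals_set ring_of_integers\<^esub> n.
                       \<exists>w \<in> carrier ring_of_integers - P. x = u / w}"

definition padic_cauchy_ring :: "'k::field_char_0 set \<Rightarrow> (nat \<Rightarrow> 'k) ring" where
  "padic_cauchy_ring P =
     \<lparr>carrier = {s. \<forall>n. \<exists>N. \<forall>i\<ge>N. \<forall>j\<ge>N. s i - s j \<in> padic_nhd P n},
      monoid.mult = (\<lambda>s t i. s i * t i), one = (\<lambda>_. 1),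
      ring.zero = (\<lambda>_. 0), add = (\<lambda>s t i. s i + t i)\<rparr>"

definition padic_null :: "'k::field_char_0 set \<Rightarrow> (nat \<Rightarrow> 'k) set" where
  "padic_null P = {s. \<forall>n. \<exists>N. \<forall>i\<ge>N. s i \<in> padic_nhd P n}"

definition padic_completion :: "'k::field_char_0 set \<Rightarrow> (nat \<Rightarrow> 'k) set ring" where
  "padic_completion P = padic_cauchy_ring P Quot padic_null P"

definition padic_embed :: "'k::field_char_0 set \<Rightarrow> 'k \<Rightarrow> (nat \<Rightarrow> 'k) set" where
  "padic_embed P x = padic_null P +>\<^bsub>padic_cauchy_ring P\<^esub> (\<lambda>_. x)"

definition division_ring :: "('a, 'm) ring_scheme \<Rightarrow> bool" where
  "division_ring D \<longleftrightarrow> ring D \<and> Units D = carrier D - {\<zero>\<^bsub>D\<^esub>}"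

text \<open>\<open>A\<close> is ramified at \<open>P\<close> if \<open>A \<otimes>\<^sub>k k\<^sub>P\<close> is a division algebra.\<close>

definition Ram_f :: "'k::field_char_0 \<Rightarrow> 'k \<Rightarrow> 'k set set" where
  "Ram_f a b = {P \<in> prime_ideals ring_of_integers.
     division_ring (quaternion_algebra (padic_completion P) (padic_embed P a) (padic_embed P b))}"

text \<open>\<open>quat_disc\<close> is \<open>\<Delta>(A)\<close>; for nonzero \<open>a\<close>, \<open>b\<close> the set \<open>Ram_f a b\<close> is finite.\<close>

definition quat_disc :: "'k::field_char_0 \<Rightarrow> 'k \<Rightarrow> 'k set" where
  "quat_disc a b = finprod (ideals_set ring_of_integers) (\<lambda>P. P) (Ram_f a b)"

abbreviation quat_alg :: "'k::field_char_0 \<Rightarrow> 'k \<Rightarrow> 'k quad ring" where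
  "quat_alg \<equiv> quaternion_algebra ring_of_type_algebra"

definition span_R :: "'k::field_char_0 \<Rightarrow> 'k \<Rightarrow> 'k quad list \<Rightarrow> 'k quad set" where
  "span_R a b = ring.Span (quat_alg a b)
     (quat_scalar ring_of_type_algebra ` carrier ring_of_integers)"

definition span_k :: "'k::field_char_0 \<Rightarrow> 'k \<Rightarrow> 'k quad list \<Rightarrow> 'k quad set" where
  "span_k a b = ring.Span (quat_alg a b)
     (quat_scalar ring_of_type_algebra ` carrier ring_of_type_algebra)"

definition complete_R_lattice :: "'k::field_char_0 \<Rightarrow> 'k \<Rightarrow> 'k quad set \<Rightarrow> bool" where
  "complete_R_lattice a b L \<longleftrightarrow>
     (\<exists>us. set us \<subseteq> carrier (quat_alg a b) \<and> L = span_R a b us) \<and>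
     (\<exists>vs. set vs \<subseteq> L \<and> span_k a b vs = carrier (quat_alg a b))"

definition quat_order :: "'k::field_char_0 \<Rightarrow> 'k \<Rightarrow> 'k quad set \<Rightarrow> bool" where
  "quat_order a b L \<longleftrightarrow> complete_R_lattice a b L \<and> subring L (quat_alg a b)"

definition maximal_order :: "'k::field_char_0 \<Rightarrow> 'k \<Rightarrow> 'k quad set \<Rightarrow> bool" where
  "maximal_order a b L \<longleftrightarrow>
     quat_order a b L \<and> (\<forall>M. quat_order a b M \<and> L \<subseteq> M \<longrightarrow> M = L)"

definition standard_order :: "'k::field_char_0 \<Rightarrow> 'k \<Rightarrow> 'k quad set" where
  "standard_order a b =
     (let K = ring_of_type_algebra; A = quat_alg a b
      in span_R a b [\<one>\<^bsub>A\<^esub>, quat_i K, quat_j K, quat_i K \<otimes>\<^bsub>A\<^esub> quat_j K])"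

end

theory Submission
  imports Defs "Jordan_Normal_Form.Char_Poly"
begin

text \<open>
  Write \<open>\<beta> = x\<^sub>0 + x\<^sub>1 i + x\<^sub>2 j + x\<^sub>3 ij\<close>, and let \<open>N\<close> be the reduced norm.  The claim is that every
  \<open>2 r x\<^sub>m\<close> is an algebraic integer.  An element of \<open>k\<close> that is integral at every prime \<open>P\<close> is
  integral (\<open>local_global_integral\<close>), so the claim can be checked one prime at a time.

  Norms and traces of elements of an order are integral.  For the norm, \<open>N(\<beta>)\<^sup>n = N(\<beta>\<^sup>n)\<close> has a
  denominator independent of \<open>n\<close>, since the order is a lattice, and \<open>R\<close> is completely integrally
  closed (\<open>order_norm_integral\<close>); the trace is \<open>N(\<beta> + 1) - N(\<beta>) - 1\<close>.  The traces of \<open>\<beta>\<close>,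
  \<open>i\<beta>\<close>, \<open>j\<beta>\<close> and \<open>ij\<beta>\<close> show that every \<open>2 a b x\<^sub>m\<close> is integral
  (\<open>order_coordinates_times_ab\<close>).  This settles the primes not dividing \<open>ab\<close>, and also the
  unramified primes dividing \<open>ab\<close>: there \<open>ab\<close> has valuation 1, and \<open>r\<close> supplies one factor \<open>\<pi>\<close>.

  At a ramified prime \<open>2 x\<^sub>m\<close> itself must be integral.  The reason is the different of the
  maximal order of the local division algebra: if \<open>\<gamma>\<close> has norm of valuation at least \<open>-1\<close>, then its
  trace is integral.  Indeed, if the trace \<open>t\<close> were not, \<open>\<gamma> / t\<close> would be a root of
  \<open>X\<^sup>2 - X + c\<close> with \<open>c\<close> of positive valuation.  By Hensel's lemma that polynomial splits over the
  completion, with two distinct roots, which contradicts the absence of zero divisors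
  (\<open>ramified_no_split_polynomial\<close>, \<open>ramified_trace_integral\<close>).  The argument does not distinguish
  dyadic primes.  It is applied to \<open>\<gamma> = \<beta>\<close>, \<open>i\<inverse>\<beta>\<close>, \<open>j\<inverse>\<beta>\<close> and \<open>(ij)\<inverse>\<beta>\<close>, whose traces are
  the \<open>2 x\<^sub>m\<close> up to sign, and whose norms have valuation at least \<open>-1\<close> because \<open>ab\<close> is square-free.

  Finally \<open>r\<close> has to contain the right primes: a prime divides \<open>\<Delta>(A)\<close> exactly if it is
  ramified (\<open>divides_quat_disc_iff\<close>).  As \<open>\<Delta>(A)\<close> is a product over the ramified primes, this needs
  that there are finitely many of them.  For \<open>P\<close> not dividing \<open>2ab\<close> the conic \<open>a x\<^sup>2 + b y\<^sup>2 = 1\<close>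
  has a point over the finite residue field, so \<open>1 + x i + y j\<close> has norm in \<open>P\<close> and trace 2; the
  trace criterion then shows that \<open>P\<close> is unramified (\<open>ramified_divides_2ab\<close>).
\<close>

section \<open>Algebraic integers\<close>

interpretation int_span: Modules.module "\<lambda>(c::int) (x::'k::field_char_0). of_int c * x"
  by standard (auto simp: algebra_simps)

text \<open>
  The characteristic polynomial of an integer matrix is monic with integer coefficients.
\<close>

lemma eigenvalue_of_int_matrix_algebraic_int:
  fixes z :: "'k::field_char_0" and B :: "int mat"
  assumes B: "B \<in> carrier_mat n n"
    and ev: "eigenvalue (map_mat of_int B) z"
  shows "algebraic_int z"
proof -
  have "poly (map_poly of_int (char_poly B)) z = 0"
    using ev eigenvalue_root_char_poly[of "map_mat of_int B" n z] map_carrier_mat B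
    by (metis of_int_hom.char_poly_hom[OF B])
  moreover have "lead_coeff (char_poly B) = 1"
    using degree_monic_char_poly[OF B] by simp
  ultimately show ?thesis by (auto simp: algebraic_int_altdef_ipoly)
qed

text \<open>
  The determinant trick: multiplication by \<open>z\<close> on the generators \<open>S\<close> is given by an integer matrix,
  and the vector of the elements of \<open>S\<close> is an eigenvector of it for \<open>z\<close>.
\<close>

lemma algebraic_int_if_stabilizes_span:
  fixes z :: "'k::field_char_0"
  assumes S: "finite S" "s \<in> S" "s \<noteq> 0"
    and stab: "\<And>x. x \<in> S \<Longrightarrow> z * x \<in> int_span.span S"
  shows "algebraic_int z"
proof -
  define n where "n = card S"
  obtain e where e: "bij_betw e {0..<n} S"
    using ex_bij_betw_nat_finite[OF S(1)] n_def by blast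
  have "\<exists>c. z * x = (\<Sum>y\<in>S. of_int (c y) * y)" if "x \<in> S" for x
    using stab[OF that] int_span.span_finite[OF S(1)] by auto
  then obtain c where c: "\<And>x. x \<in> S \<Longrightarrow> z * x = (\<Sum>y\<in>S. of_int (c x y) * y)"
    by metis
  define B where "B = Matrix.mat n n (\<lambda>(i, j). c (e i) (e j))"
  define v where "v = Matrix.vec n e"
  have B: "B \<in> carrier_mat n n" by (simp add: B_def)
  obtain i0 where i0: "i0 < n" "e i0 = s"
    using e S(2) by (auto simp: bij_betw_def)
  have "eigenvector (map_mat of_int B) v z"
    unfolding eigenvector_def
  proof (intro conjI)
    show "v \<in> carrier_vec (dim_row (map_mat of_int B))" by (simp add: v_def B_def)
    have "v $ i0 \<noteq> 0" using i0 S(3) by (simp add: v_def)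
    then show "v \<noteq> 0\<^sub>v (dim_row (map_mat of_int B))" using i0 by (auto simp: B_def)
    show "map_mat of_int B *\<^sub>v v = z \<cdot>\<^sub>v v"
    proof (rule eq_vecI)
      fix i assume "i < dim_vec (z \<cdot>\<^sub>v v)"
      then have i: "i < n" by (simp add: v_def)
      then have ei: "e i \<in> S" using e by (auto simp: bij_betw_def)
      have "(map_mat of_int B *\<^sub>v v) $ i = (\<Sum>j = 0..<n. of_int (c (e i) (e j)) * e j)"
        using i by (auto simp: B_def v_def scalar_prod_def intro!: sum.cong)
      also have "\<dots> = (\<Sum>y\<in>S. of_int (c (e i) y) * y)"
        by (rule sum.reindex_bij_betw[OF e])
      also have "\<dots> = z * e i" using c[OF ei] by simp
      finally show "(map_mat of_int B *\<^sub>v v) $ i = (z \<cdot>\<^sub>v v) $ i"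
        using i by (simp add: v_def)
    qed (simp add: B_def v_def)
  qed
  then have "eigenvalue (map_mat of_int B) z" unfolding eigenvalue_def by blast
  then show ?thesis by (rule eigenvalue_of_int_matrix_algebraic_int[OF B])
qed

lemma span_mult_stable:
  fixes z :: "'k::field_char_0"
  assumes "\<And>x. x \<in> S \<Longrightarrow> z * x \<in> int_span.span S" and "y \<in> int_span.span S"
  shows "z * y \<in> int_span.span S"
  using assms(2)
proof (induction rule: int_span.span_induct_alt)
  case base
  then show ?case by (simp add: int_span.span_zero)
next
  case (step c x y)
  have "z * (of_int c * x + y) = of_int c * (z * x) + z * y" by (simp add: algebra_simps)
  then show ?case
    using step assms(1) by (auto intro!: int_span.span_add int_span.span_scale)
qed

text \<open>
  The monic equation of \<open>x\<close> expresses the power \<open>x\<^sup>m\<close> through lower ones, so the powers below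
  \<open>m\<close> span a module that is stable under \<open>x\<close>.
\<close>

lemma algebraic_int_power_in_span:
  fixes x :: "'k::field_char_0"
  assumes "algebraic_int x"
  obtains m where "m > 0" "x ^ m \<in> int_span.span ((\<lambda>i. x ^ i) ` {..<m})"
proof -
  obtain p where p: "poly (map_poly of_int p) x = 0" "lead_coeff p = 1"
    using assms by (auto simp: algebraic_int_altdef_ipoly)
  define m where "m = Polynomial.degree p"
  have dm: "Polynomial.degree (map_poly of_int p :: 'k poly) = m"
    by (simp add: m_def)
  have "m > 0"
  proof (rule ccontr)
    assume "\<not> m > 0"
    then obtain c where "p = [:c:]" using degree_eq_zeroE[of p] by (auto simp: m_def)
    then show False using p by simp
  qed
  have "(\<Sum>i\<le>m. of_int (Polynomial.coeff p i) * x ^ i) = 0"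
    using p(1) unfolding poly_altdef dm by simp
  then have "x ^ m + (\<Sum>i<m. of_int (Polynomial.coeff p i) * x ^ i) = 0"
    using p(2) unfolding lessThan_Suc_atMost[symmetric] m_def[symmetric]
    by (simp add: add.commute)
  then have "x ^ m = - (\<Sum>i<m. of_int (Polynomial.coeff p i) * x ^ i)"
    by (simp only: eq_neg_iff_add_eq_0)
  moreover have "\<dots> \<in> int_span.span ((\<lambda>i. x ^ i) ` {..<m})"
    by (intro int_span.span_neg int_span.span_sum int_span.span_scale int_span.span_base) auto
  ultimately show thesis using that \<open>m > 0\<close> by simp
qed

lemma span_image_mult:
  fixes x :: "'k::field_char_0"
  assumes "y \<in> int_span.span S" "\<And>s. s \<in> S \<Longrightarrow> c * s \<in> T"
  shows "c * y \<in> int_span.span T"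
  using assms(1)
proof (induction rule: int_span.span_induct_alt)
  case base
  then show ?case by (simp add: int_span.span_zero)
next
  case (step d x y)
  have "c * (of_int d * x + y) = of_int d * (c * x) + c * y" by (simp add: algebra_simps)
  then show ?case
    using step assms(2) by (simp add: int_span.span_add int_span.span_scale int_span.span_base)
qed

text \<open>
  The products \<open>x\<^sup>i y\<^sup>j\<close> with bounded exponents do it.  A module stable under \<open>x\<close> and \<open>y\<close> is stable
  under \<open>x + y\<close> and \<open>xy\<close>, which is how closure under addition and multiplication is obtained.
\<close>

lemma algebraic_ints_stabilize_common_span:
  fixes x y :: "'k::field_char_0"
  assumes "algebraic_int x" "algebraic_int y"
  obtains S where "finite S" "1 \<in> S"
    "\<And>s. s \<in> S \<Longrightarrow> x * s \<in> int_span.span S" "\<And>s. s \<in> S \<Longrightarrow> y * s \<in> int_span.span S"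
proof -
  obtain m where m: "m > 0" "x ^ m \<in> int_span.span ((\<lambda>i. x ^ i) ` {..<m})"
    using algebraic_int_power_in_span[OF assms(1)] .
  obtain n where n: "n > 0" "y ^ n \<in> int_span.span ((\<lambda>i. y ^ i) ` {..<n})"
    using algebraic_int_power_in_span[OF assms(2)] .
  define S where "S = (\<lambda>(i, j). x ^ i * y ^ j) ` ({..<m} \<times> {..<n})"
  show thesis
  proof (rule that)
    show "finite S" by (simp add: S_def)
    show "1 \<in> S" using m n by (auto simp: S_def intro!: image_eqI[of _ _ "(0, 0)"])
    fix s assume "s \<in> S"
    then obtain i j where s: "s = x ^ i * y ^ j" and i: "i < m" and j: "j < n"
      by (auto simp: S_def)
    show "x * s \<in> int_span.span S"
    proof (cases "Suc i < m")
      case True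
      then show ?thesis using j
        by (auto simp: s S_def intro!: int_span.span_base image_eqI[of _ _ "(Suc i, j)"])
    next
      case False
      then have "x * s = y ^ j * x ^ m" using i s
        by (metis Suc_lessI mult.assoc mult.commute power_Suc)
      moreover have "y ^ j * x ^ m \<in> int_span.span S"
        by (rule span_image_mult[OF m(2)]) (use j in \<open>auto simp: S_def mult.commute[of "y ^ j"]\<close>)
      ultimately show ?thesis by simp
    qed
    show "y * s \<in> int_span.span S"
    proof (cases "Suc j < n")
      case True
      then show ?thesis using i
        by (auto simp: s S_def intro!: int_span.span_base image_eqI[of _ _ "(i, Suc j)"])
    next
      case False
      then have "y * s = x ^ i * y ^ n" using j s
        by (metis Suc_lessI mult.left_commute power_Suc)
      moreover have "x ^ i * y ^ n \<in> int_span.span S"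
        by (rule span_image_mult[OF n(2)]) (use i in \<open>auto simp: S_def\<close>)
      ultimately show ?thesis by simp
    qed
  qed
qed

lemma algebraic_int_add:
  fixes x y :: "'k::field_char_0"
  assumes "algebraic_int x" "algebraic_int y"
  shows "algebraic_int (x + y)"
proof -
  obtain S where S: "finite S" "1 \<in> S"
    "\<And>s. s \<in> S \<Longrightarrow> x * s \<in> int_span.span S" "\<And>s. s \<in> S \<Longrightarrow> y * s \<in> int_span.span S"
    using algebraic_ints_stabilize_common_span[OF assms] by blast
  show ?thesis
    by (rule algebraic_int_if_stabilizes_span[OF S(1,2)])
       (simp_all add: distrib_right int_span.span_add S)
qed

lemma algebraic_int_mult:
  fixes x y :: "'k::field_char_0"
  assumes "algebraic_int x" "algebraic_int y"
  shows "algebraic_int (x * y)"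
proof -
  obtain S where S: "finite S" "1 \<in> S"
    "\<And>s. s \<in> S \<Longrightarrow> x * s \<in> int_span.span S" "\<And>s. s \<in> S \<Longrightarrow> y * s \<in> int_span.span S"
    using algebraic_ints_stabilize_common_span[OF assms] by blast
  show ?thesis
  proof (rule algebraic_int_if_stabilizes_span[OF S(1,2)])
    show "x * y * s \<in> int_span.span S" if "s \<in> S" for s
      unfolding mult.assoc by (rule span_mult_stable[OF S(3) S(4)[OF that]])
  qed simp
qed

lemma algebraic_int_diff:
  fixes x y :: "'k::field_char_0"
  shows "algebraic_int x \<Longrightarrow> algebraic_int y \<Longrightarrow> algebraic_int (x - y)"
  using algebraic_int_add[of x "- y"] by simp

lemma algebraic_int_power:
  fixes x :: "'k::field_char_0"
  shows "algebraic_int x \<Longrightarrow> algebraic_int (x ^ n)"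
  by (induction n) (auto intro: algebraic_int_mult)

lemma algebraic_int_prod:
  fixes f :: "'a \<Rightarrow> 'k::field_char_0"
  shows "(\<And>x. x \<in> F \<Longrightarrow> algebraic_int (f x)) \<Longrightarrow> algebraic_int (prod f F)"
  by (induction F rule: infinite_finite_induct) (auto intro: algebraic_int_mult)

section \<open>Number fields\<close>

text \<open>
  The dimension over the rationals bounds the length of a sequence without a linear relation; a
  relation with rational coefficients becomes one with integer coefficients after clearing
  denominators.  The same \<open>n\<close> works for all sequences.
\<close>

lemma number_field_int_relation:
  assumes "number_field TYPE('k::field_char_0)"
  obtains n where "\<And>f :: nat \<Rightarrow> 'k. \<exists>c :: nat \<Rightarrow> int. (\<exists>i\<le>n. c i \<noteq> 0) \<and> (\<Sum>i\<le>n. of_int (c i) * f i) = 0"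
proof -
  obtain B where "finite_dimensional_vector_space (\<lambda>q (x::'k). of_rat q * x) B"
    using assms by (auto simp: number_field_def)
  then interpret fd: finite_dimensional_vector_space "\<lambda>q (x::'k). of_rat q * x" B .
  show thesis
  proof (rule that[of "card B"])
    fix f :: "nat \<Rightarrow> 'k"
    have "\<exists>q :: nat \<Rightarrow> rat. (\<exists>i\<le>card B. q i \<noteq> 0) \<and> (\<Sum>i\<le>card B. of_rat (q i) * f i) = 0"
    proof (cases "inj_on f {..card B}")
      case False
      then obtain i j where ij: "i \<le> card B" "j \<le> card B" "i \<noteq> j" "f i = f j"
        by (auto simp: inj_on_def)
      let ?q = "\<lambda>k. if k = i then 1 else if k = j then -1 else (0::rat)"
      have "(\<Sum>k\<le>card B. of_rat (?q k) * f k) = (\<Sum>k\<in>{i, j}. of_rat (?q k) * f k)"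
        using ij by (intro sum.mono_neutral_right) auto
      also have "\<dots> = 0" using ij by simp
      finally show ?thesis using ij by (intro exI[of _ ?q]) auto
    next
      case True
      have "fd.dependent (f ` {..card B})"
        using fd.independent_card_le_dim[of "f ` {..card B}" UNIV] fd.dim_UNIV card_image[OF True]
          fd.dimension_def by auto
      then obtain u where u: "\<exists>v\<in>f ` {..card B}. u v \<noteq> 0" "(\<Sum>v\<in>f ` {..card B}. of_rat (u v) * v) = 0"
        using fd.dependent_finite[of "f ` {..card B}"] by auto
      then show ?thesis
        by (intro exI[of _ "u \<circ> f"]) (auto simp: sum.reindex[OF True])
    qed
    then obtain q :: "nat \<Rightarrow> rat" where q: "\<exists>i\<le>card B. q i \<noteq> 0" "(\<Sum>i\<le>card B. of_rat (q i) * f i) = 0"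
      by blast
    define den where "den i = snd (quotient_of (q i))" for i
    define N where "N = (\<Prod>i\<le>card B. den i)"
    have den: "den i > 0" for i by (simp add: den_def quotient_of_denom_pos')
    have N: "N > 0" unfolding N_def using den by (simp add: prod_pos)
    have "\<exists>m::int. of_int N * q i = of_int m" if "i \<le> card B" for i
    proof -
      have "den i dvd N" unfolding N_def using that by (intro dvd_prodI) auto
      then obtain l where l: "N = den i * l" by blast
      have "of_int (den i) * q i = of_int (fst (quotient_of (q i)))"
        using quotient_of_div[of "q i" "fst (quotient_of (q i))" "den i"] den[of i]
        by (simp add: den_def field_simps)
      then have "of_int N * q i = of_int (fst (quotient_of (q i)) * l)"
        by (simp add: l mult.commute mult.left_commute)
      then show ?thesis by blast
    qed
    then obtain c where c: "\<And>i. i \<le> card B \<Longrightarrow> of_int N * q i = (of_int (c i) :: rat)" by metis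
    have "of_int (c i) = (of_int N * of_rat (q i) :: 'k)" if "i \<le> card B" for i
      using arg_cong[OF c[OF that], of "of_rat :: rat \<Rightarrow> 'k"] by (simp add: of_rat_mult)
    then have "(\<Sum>i\<le>card B. of_int (c i) * f i) = of_int N * (\<Sum>i\<le>card B. of_rat (q i) * f i)"
      by (simp add: sum_distrib_left mult.assoc)
    moreover have "\<exists>i\<le>card B. c i \<noteq> 0"
    proof -
      obtain i where i: "i \<le> card B" "q i \<noteq> 0" using q(1) by blast
      then have "(of_int (c i) :: rat) \<noteq> 0" using c[OF i(1), symmetric] N by simp
      then show ?thesis using i(1) by auto
    qed
    ultimately show "\<exists>c :: nat \<Rightarrow> int. (\<exists>i\<le>card B. c i \<noteq> 0) \<and> (\<Sum>i\<le>card B. of_int (c i) * f i) = 0"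
      using q(2) by auto
  qed
qed

text \<open>
  If \<open>c\<close> is the leading coefficient of an integer polynomial with root \<open>x\<close>, then multiplying the
  equation by a power of \<open>c\<close> makes it monic in \<open>cx\<close>.
\<close>

lemma number_field_integer_denominator:
  fixes x :: "'k::field_char_0"
  assumes "number_field TYPE('k)"
  obtains c :: int where "c \<noteq> 0" "algebraic_int (of_int c * x)"
proof -
  obtain n where n: "\<And>f :: nat \<Rightarrow> 'k. \<exists>c :: nat \<Rightarrow> int. (\<exists>i\<le>n. c i \<noteq> 0) \<and> (\<Sum>i\<le>n. of_int (c i) * f i) = 0"
    using number_field_int_relation[OF assms] by blast
  obtain c :: "nat \<Rightarrow> int" where c: "\<exists>i\<le>n. c i \<noteq> 0" "(\<Sum>i\<le>n. of_int (c i) * x ^ i) = 0"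
    using n[of "\<lambda>i. x ^ i"] by blast
  define m where "m = (GREATEST i. i \<le> n \<and> c i \<noteq> 0)"
  have m: "m \<le> n \<and> c m \<noteq> 0"
    unfolding m_def by (rule GreatestI_ex_nat[of _ n]) (use c in auto)
  have max: "c i = 0" if "m < i" "i \<le> n" for i
    using Greatest_le_nat[of "\<lambda>i. i \<le> n \<and> c i \<noteq> 0" i n] that m_def by auto
  let ?C = "of_int (c m) :: 'k"
  have "(\<Sum>i\<le>n. of_int (c i) * x ^ i) = (\<Sum>i\<le>m. of_int (c i) * x ^ i)"
    using m max by (intro sum.mono_neutral_right) (auto simp: not_le)
  then have rel: "?C * x ^ m + (\<Sum>i<m. of_int (c i) * x ^ i) = 0"
    using c(2) by (simp add: lessThan_Suc_atMost[symmetric] add.commute)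
  have m0: "m > 0" using rel m by (cases m) auto
  define S where "S = (\<lambda>i. (?C * x) ^ i) ` {..<m}"
  have "algebraic_int (?C * x)"
  proof (rule algebraic_int_if_stabilizes_span[of S 1])
    show "finite S" "1 \<in> S" using m0 by (auto simp: S_def intro!: image_eqI[of _ _ 0])
    fix s assume "s \<in> S"
    then obtain i where i: "i < m" "s = (?C * x) ^ i" by (auto simp: S_def)
    show "(?C * x) * s \<in> int_span.span S"
    proof (cases "Suc i < m")
      case True
      then show ?thesis using i by (auto simp: S_def intro!: int_span.span_base image_eqI[of _ _ "Suc i"])
    next
      case False
      then have im: "m = Suc i" using i by simp
      have "?C * x * s = ?C ^ i * (?C * x ^ m)" by (simp add: i im power_mult_distrib)
      also have "\<dots> = - (\<Sum>l<m. ?C ^ i * (of_int (c l) * x ^ l))"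
        unfolding sum_distrib_left[symmetric] using rel
        by (simp add: eq_neg_iff_add_eq_0[symmetric])
      also have "\<dots> = - (\<Sum>l<m. of_int (c m ^ (i - l) * c l) * (?C * x) ^ l)"
      proof (intro arg_cong[of _ _ uminus] sum.cong refl)
        fix l assume "l \<in> {..<m}"
        then have "?C ^ i = ?C ^ (i - l) * ?C ^ l" by (simp add: im flip: power_add)
        then show "?C ^ i * (of_int (c l) * x ^ l) = of_int (c m ^ (i - l) * c l) * (?C * x) ^ l"
          by (simp add: power_mult_distrib)
      qed
      also have "\<dots> \<in> int_span.span S"
        by (intro int_span.span_neg int_span.span_sum int_span.span_scale int_span.span_base) (auto simp: S_def)
      finally show ?thesis .
    qed
  qed auto
  then show thesis using that[of "c m"] m by auto
qed

section \<open>The ring of integers in class number one\<close>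

lemma ring_of_integers_simps [simp]:
  "carrier (ring_of_integers :: 'k::field_char_0 ring) = {x. algebraic_int x}"
  "x \<otimes>\<^bsub>ring_of_integers\<^esub> y = x * y"
  "x \<oplus>\<^bsub>ring_of_integers\<^esub> y = x + y"
  "\<one>\<^bsub>ring_of_integers\<^esub> = (1 :: 'k)"
  "\<zero>\<^bsub>ring_of_integers\<^esub> = (0 :: 'k)"
  by (simp_all add: ring_of_integers_def ring_of_type_algebra_def)

lemma domain_ring_of_integers: "domain (ring_of_integers :: 'k::field_char_0 ring)"
proof -
  have "\<exists>y. algebraic_int y \<and> y + x = 0" if "algebraic_int x" for x :: 'k
    using that by (intro exI[of _ "- x"]) auto
  then have "abelian_group (ring_of_integers :: 'k ring)"
    by (intro abelian_groupI) (auto simp: algebraic_int_add)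
  moreover have "Group.comm_monoid (ring_of_integers :: 'k ring)"
    by (intro comm_monoidI) (auto simp: algebraic_int_mult)
  ultimately have "cring (ring_of_integers :: 'k ring)"
    by (intro cringI) (auto simp: distrib_right)
  then show ?thesis by (rule domain.intro) (unfold_locales, auto)
qed

lemma cgenideal_ring_of_integers:
  "PIdl\<^bsub>ring_of_integers\<^esub> (g :: 'k::field_char_0) = {x * g | x. algebraic_int x}"
  by (auto simp: cgenideal_def)

locale class_number_one =
  fixes k :: "'k::field_char_0 itself"
  assumes number_field: "number_field TYPE('k)"
    and class_number: "class_number (ring_of_integers :: 'k ring) = 1"
begin

abbreviation \<R> :: "'k ring" where "\<R> \<equiv> ring_of_integers"

interpretation R: domain \<R>
  by (rule domain_ring_of_integers)

text \<open>
  With a single ideal class, every nonzero ideal \<open>I\<close> is equivalent to the unit ideal: \<open>xI = yR\<close>, and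
  then \<open>y / x\<close> generates \<open>I\<close>.
\<close>

lemma principal_domain_ring_of_integers: "principal_domain \<R>"
proof (unfold_locales)
  fix I assume I: "ideal I \<R>"
  show "\<exists>g\<in>carrier \<R>. I = PIdl\<^bsub>\<R>\<^esub> g"
  proof (cases "I = {0}")
    case True
    then show ?thesis
      by (intro bexI[of _ 0]) (auto simp: cgenideal_ring_of_integers)
  next
    case False
    then have In: "I \<in> nonzero_ideals \<R>" using I by (simp add: nonzero_ideals_def)
    have "(1 :: 'k) \<in> carrier \<R>" by simp
    then have "carrier \<R> \<noteq> {0}" by (metis singletonD one_neq_zero)
    then have Jn: "carrier \<R> \<in> nonzero_ideals \<R>"
      using R.oneideal by (simp add: nonzero_ideals_def)
    have refl: "(J, J) \<in> ideal_class_rel \<R>" if "J \<in> nonzero_ideals \<R>" for J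
      unfolding ideal_class_rel_def using that
      by (auto intro!: bexI[of _ 1])
    obtain Q where Q: "nonzero_ideals \<R> // ideal_class_rel \<R> = {Q}"
      using class_number unfolding class_number_def by (metis card_1_singletonE)
    have "ideal_class_rel \<R> `` {J} = Q" if "J \<in> nonzero_ideals \<R>" for J
      using quotientI[OF that, of "ideal_class_rel \<R>"] Q by simp
    then have "carrier \<R> \<in> ideal_class_rel \<R> `` {I}"
      using In Jn refl[OF Jn] by (metis Image_singleton_iff)
    then obtain x y where xy: "algebraic_int x" "x \<noteq> 0" "y \<noteq> 0"
      "x <#\<^bsub>\<R>\<^esub> I = y <#\<^bsub>\<R>\<^esub> carrier \<R>"
      by (auto simp: ideal_class_rel_def)
    then have "y \<in> x <#\<^bsub>\<R>\<^esub> I" by (auto simp: l_coset_def intro!: exI[of _ 1])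
    then obtain g where g: "g \<in> I" "y = x * g" by (auto simp: l_coset_def)
    have gR: "g \<in> carrier \<R>" using ideal.Icarr[OF I g(1)] .
    have "I \<subseteq> PIdl\<^bsub>\<R>\<^esub> g"
    proof
      fix i assume "i \<in> I"
      then have "x * i \<in> y <#\<^bsub>\<R>\<^esub> carrier \<R>"
        using xy(4) by (auto simp: l_coset_def)
      then obtain r where "algebraic_int r" "x * i = y * r" by (auto simp: l_coset_def)
      then have "i = r * g" using xy g by (simp add: mult.commute)
      then show "i \<in> PIdl\<^bsub>\<R>\<^esub> g" using \<open>algebraic_int r\<close> by (auto simp: cgenideal_ring_of_integers)
    qed
    moreover have "PIdl\<^bsub>\<R>\<^esub> g \<subseteq> I" by (rule R.cgenideal_minimal[OF I g(1)])
    ultimately show ?thesis using gR by blast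
  qed
qed

sublocale R: principal_domain \<R>
  by (rule principal_domain_ring_of_integers)

lemma prime_ideal_generator:
  assumes "P \<in> prime_ideals \<R>"
  obtains p where "algebraic_int p" "PIdl\<^bsub>\<R>\<^esub> p = P"
  using R.exists_gen[of P] assms by (auto simp: prime_ideals_def primeideal_def)

lemma principal_generator_nonzero:
  assumes "P \<in> prime_ideals \<R>" "PIdl\<^bsub>\<R>\<^esub> p = P"
  shows "p \<noteq> 0"
proof
  assume "p = 0"
  then have "P = {0}" using assms(2) by (auto simp: cgenideal_ring_of_integers intro!: exI[of _ 0])
  then show False using assms(1) by (simp add: prime_ideals_def)
qed

lemma fraction:
  obtains d where "d \<noteq> 0" "algebraic_int d" "algebraic_int (d * (x :: 'k))"
proof -
  obtain c :: int where "c \<noteq> 0" "algebraic_int (of_int c * x)"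
    using number_field_integer_denominator[OF number_field] by blast
  then show thesis using that[of "of_int c"] by simp
qed

end

section \<open>Localization at a prime\<close>

definition local_ring :: "'k::field_char_0 set \<Rightarrow> 'k set" where
  "local_ring P = {u / w | u w. algebraic_int u \<and> algebraic_int w \<and> w \<notin> P}"

locale prime_with_generator = class_number_one k for k :: "'k::field_char_0 itself" +
  fixes P :: "'k set" and p :: 'k
  assumes prime: "P \<in> prime_ideals \<R>" and p_int: "algebraic_int p" and gen: "PIdl\<^bsub>\<R>\<^esub> p = P"
begin

abbreviation L where "L \<equiv> local_ring P"

lemma primeideal: "primeideal P \<R>"
  using prime by (simp add: prime_ideals_def)

sublocale PI: primeideal P \<R>
  by (rule primeideal)

lemma mem_P_iff: "x \<in> P \<longleftrightarrow> (\<exists>y. algebraic_int y \<and> x = p * y)"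
  unfolding gen[symmetric] cgenideal_ring_of_integers by (auto simp: mult.commute)

lemma p_in_P: "p \<in> P" by (auto simp: mem_P_iff intro: exI[of _ 1])

lemma p_nonzero: "p \<noteq> 0"
  using principal_generator_nonzero[OF prime gen] .

lemma P_prime: "algebraic_int x \<Longrightarrow> algebraic_int y \<Longrightarrow> x * y \<in> P \<Longrightarrow> x \<in> P \<or> y \<in> P"
  using PI.I_prime[of x y] by simp

lemma one_notin_P: "1 \<notin> P"
  using PI.one_imp_carrier PI.I_notcarr by auto

lemma P_add: "x \<in> P \<Longrightarrow> y \<in> P \<Longrightarrow> x + y \<in> P"
  using PI.a_closed by simp

lemma P_mult: "x \<in> P \<Longrightarrow> algebraic_int y \<Longrightarrow> x * y \<in> P"
  using PI.I_r_closed by simp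

lemma P_minus: "x \<in> P \<Longrightarrow> - x \<in> P"
  using P_mult[of x "-1"] by simp

text \<open>
  If \<open>x\<close> were divisible by all powers of \<open>p\<close>, the ideals generated by the \<open>x / p\<^sup>n\<close> would form a
  strictly increasing chain.
\<close>

lemma prime_power_decomposition:
  assumes "algebraic_int x" "x \<noteq> 0"
  obtains n w where "algebraic_int w" "w \<notin> P" "x = p ^ n * w"
proof -
  have "\<exists>n w. algebraic_int w \<and> w \<notin> P \<and> x = p ^ n * w"
  proof (rule ccontr)
    assume no: "\<not> ?thesis"
    have int: "algebraic_int (x / p ^ n)" for n
    proof (induction n)
      case (Suc n)
      have "x = p ^ n * (x / p ^ n)" using p_nonzero by simp
      then have "x / p ^ n \<in> P" using no Suc by blast
      then obtain y where "algebraic_int y" "x / p ^ n = p * y" by (auto simp: mem_P_iff)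
      then show ?case using p_nonzero by (simp add: field_simps)
    qed (use assms in simp)
    define C where "C = range (\<lambda>n. PIdl\<^bsub>\<R>\<^esub> (x / p ^ n))"
    have step: "PIdl\<^bsub>\<R>\<^esub> (x / p ^ m) \<subseteq> PIdl\<^bsub>\<R>\<^esub> (x / p ^ n)" if "m \<le> n" for m n
    proof
      fix z assume "z \<in> PIdl\<^bsub>\<R>\<^esub> (x / p ^ m)"
      then obtain y where y: "algebraic_int y" "z = y * (x / p ^ m)"
        by (auto simp: cgenideal_ring_of_integers)
      have "p ^ n = p ^ (n - m) * p ^ m" using that by (simp flip: power_add)
      then have "z = (y * p ^ (n - m)) * (x / p ^ n)" using y p_nonzero by simp
      then show "z \<in> PIdl\<^bsub>\<R>\<^esub> (x / p ^ n)"
        unfolding cgenideal_ring_of_integers using y p_int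
        by (blast intro: algebraic_int_mult algebraic_int_power)
    qed
    have "subset.chain {I. ideal I \<R>} C"
      unfolding subset_chain_def
    proof (intro conjI ballI subsetI)
      fix I assume "I \<in> C"
      then obtain n where "I = PIdl\<^bsub>\<R>\<^esub> (x / p ^ n)" unfolding C_def by blast
      then show "I \<in> {I. ideal I \<R>}" using R.cgenideal_ideal[of "x / p ^ n"] int by simp
    next
      fix I J assume "I \<in> C" "J \<in> C"
      then obtain m n where "I = PIdl\<^bsub>\<R>\<^esub> (x / p ^ m)" "J = PIdl\<^bsub>\<R>\<^esub> (x / p ^ n)"
        by (auto simp: C_def)
      then show "I \<subseteq> J \<or> J \<subseteq> I" using step[of m n] step[of n m] nat_le_linear by blast
    qed
    then have "\<Union>C \<in> C" using R.ideal_chain_is_trivial[of C] by (auto simp: C_def)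
    then obtain N where N: "\<Union>C = PIdl\<^bsub>\<R>\<^esub> (x / p ^ N)" by (auto simp: C_def)
    have "x / p ^ Suc N \<in> \<Union>C"
      unfolding C_def using R.cgenideal_self[of "x / p ^ Suc N"] int[of "Suc N"]
      by (intro UN_I[of "Suc N"]) simp_all
    then obtain y where y: "algebraic_int y" "x / p ^ Suc N = y * (x / p ^ N)"
      unfolding N by (auto simp: cgenideal_ring_of_integers)
    have "x / p ^ N = p * (x / p ^ Suc N)" using p_nonzero by simp
    also have "\<dots> = (p * y) * (x / p ^ N)" unfolding y(2) by simp
    finally have "1 = p * y" using assms p_nonzero by simp
    then show False using one_notin_P y by (auto simp: mem_P_iff)
  qed
  then show thesis using that by blast
qed

lemma local_ringI: "algebraic_int u \<Longrightarrow> algebraic_int w \<Longrightarrow> w \<notin> P \<Longrightarrow> x = u / w \<Longrightarrow> x \<in> L"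
  by (auto simp: local_ring_def)

lemma zero_in_P: "0 \<in> P"
  using PI.zero_closed by simp

lemma not_in_P_nonzero: "w \<notin> P \<Longrightarrow> w \<noteq> 0"
  using zero_in_P by auto

lemma int_in_L: "algebraic_int x \<Longrightarrow> x \<in> L"
  by (rule local_ringI[of x 1]) (auto simp: one_notin_P)

lemma L_mult: assumes "x \<in> L" "y \<in> L" shows "x * y \<in> L"
proof -
  obtain u w where x: "algebraic_int u" "algebraic_int w" "w \<notin> P" "x = u / w"
    using assms(1) by (auto simp: local_ring_def)
  obtain u' w' where y: "algebraic_int u'" "algebraic_int w'" "w' \<notin> P" "y = u' / w'"
    using assms(2) by (auto simp: local_ring_def)
  show ?thesis
    by (rule local_ringI[of "u * u'" "w * w'"])
       (use x y P_prime in \<open>auto intro: algebraic_int_mult\<close>)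
qed

lemma L_add: assumes "x \<in> L" "y \<in> L" shows "x + y \<in> L"
proof -
  obtain u w where x: "algebraic_int u" "algebraic_int w" "w \<notin> P" "x = u / w"
    using assms(1) by (auto simp: local_ring_def)
  obtain u' w' where y: "algebraic_int u'" "algebraic_int w'" "w' \<notin> P" "y = u' / w'"
    using assms(2) by (auto simp: local_ring_def)
  show ?thesis
    by (rule local_ringI[of "u * w' + u' * w" "w * w'"])
       (use x y P_prime not_in_P_nonzero in
         \<open>auto intro: algebraic_int_mult algebraic_int_add simp: field_simps\<close>)
qed

lemma L_minus: "x \<in> L \<Longrightarrow> - x \<in> L"
  using L_mult[of "-1" x] by (simp add: int_in_L)

lemma L_power: "x \<in> L \<Longrightarrow> x ^ n \<in> L"
  by (induction n) (auto intro: L_mult int_in_L)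

lemma p_in_L: "p \<in> L" by (rule int_in_L[OF p_int])

lemma int_in_pL_imp_in_P:
  assumes "x \<in> L" "algebraic_int (p * x)"
  shows "p * x \<in> P"
proof -
  obtain u w where x: "algebraic_int u" "algebraic_int w" "w \<notin> P" "x = u / w"
    using assms(1) by (auto simp: local_ring_def)
  have "p * x * w = p * u" using x not_in_P_nonzero by simp
  also have "\<dots> \<in> P" using x by (auto simp: mem_P_iff)
  finally show ?thesis using P_prime[of "p * x" w] x assms by auto
qed

lemma p_not_invertible_in_L: "x \<in> L \<Longrightarrow> p * x \<noteq> 1"
  using int_in_pL_imp_in_P[of x] one_notin_P by auto

lemma clear_denominator:
  obtains n where "p ^ n * x \<in> L"
proof -
  obtain d where d: "d \<noteq> 0" "algebraic_int d" "algebraic_int (d * x)" using fraction .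
  obtain n w where w: "algebraic_int w" "w \<notin> P" "d = p ^ n * w"
    using prime_power_decomposition[OF d(2,1)] .
  have "p ^ n * x = (d * x) / w" using w not_in_P_nonzero by simp
  then show thesis using that local_ringI d w by blast
qed

text \<open>
  The localization is a discrete valuation ring: multiplying \<open>x\<close> by the least power of \<open>p\<close> that makes
  it integral yields a unit.
\<close>

lemma inverse_in_pL:
  assumes "x \<notin> L"
  obtains y where "y \<in> L" "1 / x = p * y"
proof -
  have "\<exists>n. p ^ n * x \<in> L" using clear_denominator by blast
  moreover define n where "n = (LEAST n. p ^ n * x \<in> L)"
  ultimately have n: "p ^ n * x \<in> L" by (metis LeastI_ex)
  have n0: "n > 0" using assms n by (cases n) auto
  have min: "p ^ (n - 1) * x \<notin> L"
    using not_less_Least[of "n - 1" "\<lambda>n. p ^ n * x \<in> L"] n0 by (simp add: n_def)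
  obtain u w where u: "algebraic_int u" "algebraic_int w" "w \<notin> P" "p ^ n * x = u / w"
    using n by (auto simp: local_ring_def)
  have pn: "p ^ n = p * p ^ (n - 1)" using n0 by (cases n) auto
  have "u \<notin> P"
  proof
    assume "u \<in> P"
    then obtain y where y: "algebraic_int y" "u = p * y" by (auto simp: mem_P_iff)
    then have "p * (p ^ (n - 1) * x) = p * (y / w)" using u(4) by (simp add: pn mult.assoc)
    then have "p ^ (n - 1) * x = y / w" using p_nonzero by (metis mult_left_cancel)
    then show False using min local_ringI y u by blast
  qed
  have "x = (p ^ n * x) / p ^ n" using p_nonzero by simp
  then have "x = u / w / p ^ n" unfolding u(4) .
  then have "1 / x = p ^ n * (w / u)" by simp
  then have "1 / x = p * (p ^ (n - 1) * (w / u))" by (simp only: pn mult.assoc)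
  moreover have "p ^ (n - 1) * (w / u) \<in> L"
    using L_mult[OF L_power[OF p_in_L] local_ringI[OF u(2,1) \<open>u \<notin> P\<close> refl]] .
  ultimately show thesis using that by blast
qed

lemma ideal_power: "P [^]\<^bsub>ideals_set \<R>\<^esub> (n::nat) = {p ^ n * y | y. algebraic_int y}"
proof (induction n)
  case 0
  then show ?case by (simp add: ideals_set_def nat_pow_def)
next
  case (Suc n)
  have "x \<in> {p ^ n * y | y. algebraic_int y} \<cdot>\<^bsub>\<R>\<^esub> P \<longleftrightarrow> (\<exists>y. x = p ^ Suc n * y \<and> algebraic_int y)" for x
  proof
    assume "x \<in> {p ^ n * y | y. algebraic_int y} \<cdot>\<^bsub>\<R>\<^esub> P"
    then show "\<exists>y. x = p ^ Suc n * y \<and> algebraic_int y"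
    proof induction
      case (prod i j)
      then obtain y z where "algebraic_int y" "algebraic_int z" "i = p ^ n * y" "j = p * z"
        by (auto simp: mem_P_iff)
      then show ?case by (intro exI[of _ "y * z"]) (auto intro: algebraic_int_mult)
    next
      case (sum s1 s2)
      then obtain y z where "algebraic_int y" "algebraic_int z" "s1 = p ^ Suc n * y" "s2 = p ^ Suc n * z"
        by blast
      then show ?case by (intro exI[of _ "y + z"]) (auto intro: algebraic_int_add simp: distrib_left)
    qed
  next
    assume "\<exists>y. x = p ^ Suc n * y \<and> algebraic_int y"
    then obtain y where y: "x = p ^ Suc n * y" "algebraic_int y" by blast
    have "(p ^ n * y) \<otimes>\<^bsub>\<R>\<^esub> p \<in> {p ^ n * y | y. algebraic_int y} \<cdot>\<^bsub>\<R>\<^esub> P"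
      by (rule ideal_prod.prod) (use y p_in_P in auto)
    then show "x \<in> {p ^ n * y | y. algebraic_int y} \<cdot>\<^bsub>\<R>\<^esub> P" using y by (simp add: mult_ac)
  qed
  then show ?case using Suc by (auto simp: ideals_set_def nat_pow_def)
qed

text \<open>
  Since \<open>P\<close> is principal, the neighbourhoods are the multiples of the powers of the uniformizer, and
  the topological arguments below reduce to arithmetic in the localization.
\<close>

lemma padic_nhd_eq: "padic_nhd P n = {p ^ n * z | z. z \<in> L}"
proof (intro Set.set_eqI iffI)
  fix x assume "x \<in> padic_nhd P n"
  then obtain y w where "algebraic_int y" "algebraic_int w" "w \<notin> P" "x = p ^ n * (y / w)"
    by (auto simp: padic_nhd_def ideal_power)
  then show "x \<in> {p ^ n * z | z. z \<in> L}" using local_ringI by blast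
next
  fix x assume "x \<in> {p ^ n * z | z. z \<in> L}"
  then obtain y w where "algebraic_int y" "algebraic_int w" "w \<notin> P" "x = (p ^ n * y) / w"
    by (auto simp: local_ring_def)
  then show "x \<in> padic_nhd P n" by (auto simp: padic_nhd_def ideal_power)
qed

end

section \<open>The completion and ramified primes\<close>

context prime_with_generator
begin

lemma nhdI: "z \<in> L \<Longrightarrow> x = p ^ n * z \<Longrightarrow> x \<in> padic_nhd P n"
  by (auto simp: padic_nhd_eq)

lemma nhdE:
  assumes "x \<in> padic_nhd P n"
  obtains z where "z \<in> L" "x = p ^ n * z"
  using assms by (auto simp: padic_nhd_eq)

lemma nhd_mono: "x \<in> padic_nhd P n \<Longrightarrow> m \<le> n \<Longrightarrow> x \<in> padic_nhd P m"
proof (elim nhdE)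
  fix z assume z: "z \<in> L" "x = p ^ n * z" "m \<le> n"
  show "x \<in> padic_nhd P m"
  proof (rule nhdI)
    show "p ^ (n - m) * z \<in> L" using z by (intro L_mult L_power p_in_L)
    show "x = p ^ m * (p ^ (n - m) * z)" using z by (simp add: mult.assoc[symmetric] flip: power_add)
  qed
qed

lemma nhd_zero: "0 \<in> padic_nhd P n"
  by (rule nhdI[of 0]) (simp_all add: int_in_L)

lemma nhd_add: "x \<in> padic_nhd P n \<Longrightarrow> y \<in> padic_nhd P n \<Longrightarrow> x + y \<in> padic_nhd P n"
  by (elim nhdE, rule nhdI[OF L_add]) (simp_all add: distrib_left)

lemma nhd_minus: "x \<in> padic_nhd P n \<Longrightarrow> - x \<in> padic_nhd P n"
  using nhdI[OF L_minus] by (metis nhdE mult_minus_right)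

lemma nhd_diff: "x \<in> padic_nhd P n \<Longrightarrow> y \<in> padic_nhd P n \<Longrightarrow> x - y \<in> padic_nhd P n"
  using nhd_add[of x n "- y"] nhd_minus by simp

lemma nhd_mult: "x \<in> padic_nhd P m \<Longrightarrow> y \<in> padic_nhd P n \<Longrightarrow> x * y \<in> padic_nhd P (m + n)"
proof (elim nhdE)
  fix z w assume zw: "z \<in> L" "w \<in> L" "x = p ^ m * z" "y = p ^ n * w"
  show "x * y \<in> padic_nhd P (m + n)"
    by (rule nhdI[OF L_mult[OF zw(1,2)]]) (simp add: zw power_add mult_ac)
qed

lemma nhd_mult_bounded:
  assumes "p ^ m * x \<in> L" "y \<in> padic_nhd P (n + m)"
  shows "x * y \<in> padic_nhd P n"
proof -
  obtain z where z: "z \<in> L" "y = p ^ (n + m) * z" using assms(2) by (rule nhdE)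
  show ?thesis
    by (rule nhdI[OF L_mult[OF assms(1) z(1)]]) (simp add: z power_add mult_ac)
qed

lemma nhd_0: "padic_nhd P 0 = L" by (simp add: padic_nhd_eq)

lemma one_notin_nhd: "1 \<notin> padic_nhd P (Suc 0)"
proof
  assume "1 \<in> padic_nhd P (Suc 0)"
  then obtain z where "z \<in> L" "1 = p * z" by (elim nhdE) simp
  then show False using p_not_invertible_in_L by metis
qed

abbreviation C where "C \<equiv> padic_cauchy_ring P"
abbreviation N where "N \<equiv> padic_null P"

lemma padic_cauchy_ring_simps [simp]:
  "s \<otimes>\<^bsub>C\<^esub> t = (\<lambda>i. s i * t i)"
  "s \<oplus>\<^bsub>C\<^esub> t = (\<lambda>i. s i + t i)"
  "\<one>\<^bsub>C\<^esub> = (\<lambda>_. 1)"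
  "\<zero>\<^bsub>C\<^esub> = (\<lambda>_. 0)"
  by (simp_all add: padic_cauchy_ring_def)

lemma mem_C_iff: "s \<in> carrier C \<longleftrightarrow> (\<forall>n. \<exists>M. \<forall>i\<ge>M. \<forall>j\<ge>M. s i - s j \<in> padic_nhd P n)"
  by (simp add: padic_cauchy_ring_def)

lemma mem_N_iff: "s \<in> N \<longleftrightarrow> (\<forall>n. \<exists>M. \<forall>i\<ge>M. s i \<in> padic_nhd P n)"
  by (simp add: padic_null_def)

lemma const_in_C: "(\<lambda>_. x) \<in> carrier C"
  by (simp add: mem_C_iff nhd_zero)

lemma null_in_C: assumes "s \<in> N" shows "s \<in> carrier C"
  unfolding mem_C_iff
proof
  fix n
  obtain M where "\<forall>i\<ge>M. s i \<in> padic_nhd P n" using assms mem_N_iff by blast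
  then show "\<exists>M. \<forall>i\<ge>M. \<forall>j\<ge>M. s i - s j \<in> padic_nhd P n" using nhd_diff by blast
qed

lemma minus_in_C: assumes "s \<in> carrier C" shows "(\<lambda>i. - s i) \<in> carrier C"
  unfolding mem_C_iff
proof
  fix n
  obtain M where "\<forall>i\<ge>M. \<forall>j\<ge>M. s i - s j \<in> padic_nhd P n" using assms mem_C_iff by blast
  then have "\<forall>i\<ge>M. \<forall>j\<ge>M. - s i - - s j \<in> padic_nhd P n" by simp
  then show "\<exists>M. \<forall>i\<ge>M. \<forall>j\<ge>M. - s i - - s j \<in> padic_nhd P n" by blast
qed

lemma add_in_C:
  assumes "s \<in> carrier C" "t \<in> carrier C"
  shows "(\<lambda>i. s i + t i) \<in> carrier C"
  unfolding mem_C_iff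
proof
  fix n
  obtain M1 where M1: "\<forall>i\<ge>M1. \<forall>j\<ge>M1. s i - s j \<in> padic_nhd P n"
    using assms(1) mem_C_iff by blast
  obtain M2 where M2: "\<forall>i\<ge>M2. \<forall>j\<ge>M2. t i - t j \<in> padic_nhd P n"
    using assms(2) mem_C_iff by blast
  have "(s i + t i) - (s j + t j) \<in> padic_nhd P n" if "i \<ge> max M1 M2" "j \<ge> max M1 M2" for i j
    using nhd_add[of "s i - s j" n "t i - t j"] M1 M2 that by (simp add: algebra_simps)
  then show "\<exists>M. \<forall>i\<ge>M. \<forall>j\<ge>M. (s i + t i) - (s j + t j) \<in> padic_nhd P n" by blast
qed

text \<open>
  A Cauchy sequence is eventually within the localization of one of its terms, whose denominator is
  a power of \<open>p\<close>.  This is what makes products of Cauchy sequences Cauchy.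
\<close>

lemma cauchy_bounded:
  assumes "s \<in> carrier C"
  obtains m M where "\<And>i. i \<ge> M \<Longrightarrow> p ^ m * s i \<in> L"
proof -
  obtain M where M: "\<forall>i\<ge>M. \<forall>j\<ge>M. s i - s j \<in> padic_nhd P 0"
    using assms mem_C_iff by blast
  obtain m where m: "p ^ m * s M \<in> L" using clear_denominator .
  have "p ^ m * s i \<in> L" if "i \<ge> M" for i
  proof -
    have "s i - s M \<in> L" using M that unfolding nhd_0 by blast
    then have "p ^ m * (s i - s M) + p ^ m * s M \<in> L"
      using m by (intro L_add[OF L_mult[OF L_power[OF p_in_L]]])
    then show ?thesis by (simp add: algebra_simps)
  qed
  then show thesis using that by blast
qed

lemma mult_in_C:
  assumes s: "s \<in> carrier C" and t: "t \<in> carrier C"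
  shows "(\<lambda>i. s i * t i) \<in> carrier C"
  unfolding mem_C_iff
proof
  fix n
  obtain m1 B1 where B1: "\<And>i. i \<ge> B1 \<Longrightarrow> p ^ m1 * s i \<in> L" using cauchy_bounded[OF s] by blast
  obtain m2 B2 where B2: "\<And>i. i \<ge> B2 \<Longrightarrow> p ^ m2 * t i \<in> L" using cauchy_bounded[OF t] by blast
  obtain M1 where M1: "\<forall>i\<ge>M1. \<forall>j\<ge>M1. s i - s j \<in> padic_nhd P (n + m2)"
    using s mem_C_iff by blast
  obtain M2 where M2: "\<forall>i\<ge>M2. \<forall>j\<ge>M2. t i - t j \<in> padic_nhd P (n + m1)"
    using t mem_C_iff by blast
  have "s i * t i - s j * t j \<in> padic_nhd P n"
    if "i \<ge> max (max M1 M2) (max B1 B2)" "j \<ge> max (max M1 M2) (max B1 B2)" for i j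
  proof -
    have "s i * (t i - t j) \<in> padic_nhd P n"
      using that M2 by (intro nhd_mult_bounded[OF B1]) auto
    moreover have "t j * (s i - s j) \<in> padic_nhd P n"
      using that M1 by (intro nhd_mult_bounded[OF B2]) auto
    ultimately have "s i * (t i - t j) + t j * (s i - s j) \<in> padic_nhd P n" by (rule nhd_add)
    then show ?thesis by (simp add: algebra_simps)
  qed
  then show "\<exists>M. \<forall>i\<ge>M. \<forall>j\<ge>M. s i * t i - s j * t j \<in> padic_nhd P n" by blast
qed

lemma mult_in_N:
  assumes s: "s \<in> carrier C" and t: "t \<in> N"
  shows "(\<lambda>i. s i * t i) \<in> N"
  unfolding mem_N_iff
proof
  fix n
  obtain m B where B: "\<And>i. i \<ge> B \<Longrightarrow> p ^ m * s i \<in> L" using cauchy_bounded[OF s] by blast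
  obtain M where M: "\<forall>i\<ge>M. t i \<in> padic_nhd P (n + m)" using t mem_N_iff by blast
  have "s i * t i \<in> padic_nhd P n" if "i \<ge> max B M" for i
    using that M by (intro nhd_mult_bounded[OF B]) auto
  then show "\<exists>M. \<forall>i\<ge>M. s i * t i \<in> padic_nhd P n" by blast
qed

lemma add_in_N:
  assumes "s \<in> N" "t \<in> N"
  shows "(\<lambda>i. s i + t i) \<in> N"
  unfolding mem_N_iff
proof
  fix n
  obtain M1 where M1: "\<forall>i\<ge>M1. s i \<in> padic_nhd P n" using assms(1) mem_N_iff by blast
  obtain M2 where M2: "\<forall>i\<ge>M2. t i \<in> padic_nhd P n" using assms(2) mem_N_iff by blast
  have "s i + t i \<in> padic_nhd P n" if "i \<ge> max M1 M2" for i
    using nhd_add M1 M2 that by simp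
  then show "\<exists>M. \<forall>i\<ge>M. s i + t i \<in> padic_nhd P n" by blast
qed

lemma cring_C: "cring C"
proof (rule cringI)
  have "\<exists>y\<in>carrier C. (\<lambda>i. y i + x i) = (\<lambda>_. 0)" if "x \<in> carrier C" for x
    by (rule bexI[OF _ minus_in_C[OF that]]) simp
  then show "abelian_group C"
    by (intro abelian_groupI) (auto simp: add_in_C const_in_C algebra_simps)
  show "Group.comm_monoid C"
    by (intro comm_monoidI) (auto simp: mult_in_C const_in_C algebra_simps)
qed (simp add: algebra_simps)

sublocale C: cring C
  by (rule cring_C)

lemma minus_C: "s \<in> carrier C \<Longrightarrow> \<ominus>\<^bsub>C\<^esub> s = (\<lambda>i. - s i)"
  by (rule C.minus_equality) (auto simp: minus_in_C)

lemma ideal_N: "ideal N C"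
proof (rule idealI)
  show "ring C" by (rule C.ring_axioms)
  have "\<ominus>\<^bsub>C\<^esub> s \<in> N" if "s \<in> N" for s
    using mult_in_N[OF const_in_C[of "-1"] that] minus_C[OF null_in_C[OF that]] by simp
  moreover have "\<zero>\<^bsub>C\<^esub> \<in> N" by (simp add: mem_N_iff nhd_zero)
  moreover have "N \<subseteq> carrier C" using null_in_C by blast
  moreover have "s \<oplus>\<^bsub>C\<^esub> t \<in> N" if "s \<in> N" "t \<in> N" for s t using add_in_N that by simp
  ultimately show "subgroup N (add_monoid C)"
    by (intro C.add.subgroupI) (auto simp: a_inv_def)
  show "x \<otimes>\<^bsub>C\<^esub> s \<in> N" if "s \<in> N" "x \<in> carrier C" for s x
    using mult_in_N[OF that(2,1)] by simp
  then show "s \<otimes>\<^bsub>C\<^esub> x \<in> N" if "s \<in> N" "x \<in> carrier C" for s x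
    using that by (simp add: mult.commute)
qed

sublocale N: ideal N C
  by (rule ideal_N)

lemma padic_completion_hom: "ring_hom_cring C (padic_completion P) ((+>\<^bsub>C\<^esub>) N)"
  unfolding padic_completion_def by (rule N.rcos_ring_hom_cring[OF cring_C])

lemma coset_zero_iff:
  assumes "s \<in> carrier C"
  shows "N +>\<^bsub>C\<^esub> s = \<zero>\<^bsub>padic_completion P\<^esub> \<longleftrightarrow> s \<in> N"
proof -
  have "\<zero>\<^bsub>padic_completion P\<^esub> = N" by (simp add: padic_completion_def FactRing_def)
  then show ?thesis
    using C.a_coset_join1[OF _ assms N.a_subgroup] N.a_rcos_const by metis
qed

end

lemma (in cring) quat_mult_conjugate:
  assumes "a \<in> carrier R" "b \<in> carrier R" "x0 \<in> carrier R" "x1 \<in> carrier R" "x2 \<in> carrier R" "x3 \<in> carrier R"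
  shows "quat_mult R a b (x0, x1, x2, x3) (x0, \<ominus> x1, \<ominus> x2, \<ominus> x3) =
    quat_scalar R (x0 \<otimes> x0 \<oplus> \<ominus> (a \<otimes> (x1 \<otimes> x1)) \<oplus> \<ominus> (b \<otimes> (x2 \<otimes> x2)) \<oplus> (a \<otimes> b) \<otimes> (x3 \<otimes> x3))"
proof -
  have e0: "x0 \<otimes> x0 \<oplus> a \<otimes> (x1 \<otimes> \<ominus> x1) \<oplus> b \<otimes> (x2 \<otimes> \<ominus> x2) \<ominus> (a \<otimes> b) \<otimes> (x3 \<otimes> \<ominus> x3) =
      x0 \<otimes> x0 \<oplus> \<ominus> (a \<otimes> (x1 \<otimes> x1)) \<oplus> \<ominus> (b \<otimes> (x2 \<otimes> x2)) \<oplus> (a \<otimes> b) \<otimes> (x3 \<otimes> x3)"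
    using assms by (simp add: a_minus_def r_minus)
  have e1: "(x0 \<otimes> \<ominus> y \<oplus> y \<otimes> x0) \<oplus> c \<otimes> (z \<otimes> \<ominus> w \<ominus> w \<otimes> \<ominus> z) = \<zero>"
    if "y \<in> carrier R" "z \<in> carrier R" "w \<in> carrier R" "c \<in> carrier R" for y z w c
    using assms that by (simp add: a_minus_def r_minus m_comm[of y] m_comm[of z] l_neg)
  have "(x0 \<otimes> \<ominus> x3 \<oplus> x3 \<otimes> x0) \<oplus> (x1 \<otimes> \<ominus> x2 \<ominus> x2 \<otimes> \<ominus> x1) = \<zero>"
    using assms by (simp add: a_minus_def r_minus m_comm[of x3] m_comm[of x1] l_neg)
  then show ?thesis using assms by (simp add: quat_scalar_def e0 e1)
qed

text \<open>
  A nonzero element of norm 0 would be a zero divisor, by multiplication with its conjugate.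
\<close>

lemma division_quaternion_anisotropic:
  fixes K (structure)
  assumes K: "cring K" and div: "division_ring (quaternion_algebra K a b)"
    and mem: "a \<in> carrier K" "b \<in> carrier K" "x0 \<in> carrier K" "x1 \<in> carrier K" "x2 \<in> carrier K" "x3 \<in> carrier K"
    and norm: "x0 \<otimes> x0 \<oplus> \<ominus> (a \<otimes> (x1 \<otimes> x1)) \<oplus> \<ominus> (b \<otimes> (x2 \<otimes> x2)) \<oplus> (a \<otimes> b) \<otimes> (x3 \<otimes> x3) = \<zero>"
  shows "x0 = \<zero>"
proof (rule ccontr)
  assume x0: "x0 \<noteq> \<zero>"
  interpret K: cring K by fact
  let ?A = "quaternion_algebra K a b"
  interpret A: ring ?A using div by (simp add: division_ring_def)
  define x where "x = (x0, x1, x2, x3)"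
  define y where "y = (x0, \<ominus> x1, \<ominus> x2, \<ominus> x3)"
  have zero: "\<zero>\<^bsub>?A\<^esub> = (\<zero>, \<zero>, \<zero>, \<zero>)" by (simp add: quaternion_algebra_def quat_scalar_def)
  have xy: "x \<in> carrier ?A" "y \<in> carrier ?A" using mem by (auto simp: x_def y_def quaternion_algebra_def)
  moreover have "x \<noteq> \<zero>\<^bsub>?A\<^esub>" using x0 by (simp add: x_def zero)
  ultimately have u: "x \<in> Units ?A" using div by (simp add: division_ring_def)
  have "x \<otimes>\<^bsub>?A\<^esub> y = \<zero>\<^bsub>?A\<^esub>"
    using K.quat_mult_conjugate[OF mem] norm by (simp add: x_def y_def quaternion_algebra_def)
  then have "inv\<^bsub>?A\<^esub> x \<otimes>\<^bsub>?A\<^esub> (x \<otimes>\<^bsub>?A\<^esub> y) = \<zero>\<^bsub>?A\<^esub>" using u by simp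
  then have "y = \<zero>\<^bsub>?A\<^esub>" using u xy by (simp flip: A.m_assoc)
  then show False using x0 by (simp add: y_def zero)
qed

definition quat_norm :: "'k::field \<Rightarrow> 'k \<Rightarrow> 'k quad \<Rightarrow> 'k" where
  "quat_norm a b = (\<lambda>(x0, x1, x2, x3). x0 * x0 - a * (x1 * x1) - b * (x2 * x2) + a * b * (x3 * x3))"

context prime_with_generator
begin

text \<open>
  Hensel's lemma for the root of \<open>X\<^sup>2 - X + c\<close> that reduces to 0, in any residue characteristic:
  the map \<open>s \<mapsto> s\<^sup>2 + c\<close> is a contraction of the maximal ideal, as
  \<open>s\<^sup>2 - t\<^sup>2 = (s - t)(s + t)\<close>, and its fixed point is the root.
\<close>

lemma hensel_sequence:
  assumes c: "c \<in> padic_nhd P (Suc 0)"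
  obtains s where "s \<in> carrier C" "\<And>n. s n \<in> padic_nhd P (Suc 0)" "(\<lambda>n. s n * s n - s n + c) \<in> N"
proof -
  define s where "s = rec_nat 0 (\<lambda>_ x. x * x + c)"
  have s0: "s 0 = 0" and sS: "s (Suc n) = s n * s n + c" for n by (simp_all add: s_def)
  have s1: "s n \<in> padic_nhd P (Suc 0)" for n
  proof (induction n)
    case (Suc n)
    have "s n * s n \<in> padic_nhd P (Suc 0)"
      using nhd_mono[OF nhd_mult[OF Suc Suc], of "Suc 0"] by simp
    then show ?case using c by (simp add: sS nhd_add)
  qed (simp add: s0 nhd_zero)
  have step: "s (Suc n) - s n \<in> padic_nhd P (Suc n)" for n
  proof (induction n)
    case (Suc n)
    have "(s (Suc n) - s n) * (s (Suc n) + s n) \<in> padic_nhd P (Suc n + Suc 0)"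
      by (intro nhd_mult nhd_add Suc s1)
    then show ?case by (simp add: sS algebra_simps)
  qed (simp add: sS s0 c)
  have far: "s (n + d) - s n \<in> padic_nhd P (Suc n)" for n d
  proof (induction d)
    case (Suc d)
    have "s (Suc (n + d)) - s (n + d) \<in> padic_nhd P (Suc n)"
      using nhd_mono[OF step] by simp
    from nhd_add[OF this Suc] show ?case by simp
  qed (simp add: nhd_zero)
  have "s i - s j \<in> padic_nhd P n" if "i \<ge> n" "j \<ge> n" for i j n
  proof -
    have "s i - s n \<in> padic_nhd P n" "s j - s n \<in> padic_nhd P n"
      using far[of n "i - n"] far[of n "j - n"] that by (auto intro: nhd_mono)
    from nhd_diff[OF this] show ?thesis by simp
  qed
  then have "s \<in> carrier C" unfolding mem_C_iff by blast
  moreover have "(\<lambda>n. s n * s n - s n + c) \<in> N"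
    unfolding mem_N_iff
  proof
    fix n
    have "s i * s i - s i + c \<in> padic_nhd P n" if "i \<ge> n" for i
      using nhd_mono[OF step[of i], of n] that by (simp add: sS algebra_simps)
    then show "\<exists>M. \<forall>i\<ge>M. s i * s i - s i + c \<in> padic_nhd P n" by blast
  qed
  ultimately show thesis using that s1 by blast
qed

text \<open>
  Here \<open>(x\<^sub>0, x\<^sub>1, x\<^sub>2, x\<^sub>3)\<close> has trace 1 and norm \<open>c\<close> in the maximal ideal.  With \<open>s\<close> a root of
  \<open>X\<^sup>2 - X + c\<close> in the completion, the norm of the quaternion minus \<open>s\<close> is
  \<open>s\<^sup>2 - s + c = 0\<close>.  In a division algebra this forces \<open>x\<^sub>0 = s\<close>, which is impossible, since
  \<open>s\<close> lies in the maximal ideal and \<open>2 x\<^sub>0 = 1\<close>.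
\<close>

lemma ramified_no_split_polynomial:
  assumes ram: "P \<in> Ram_f a b"
    and tr: "2 * x0 = 1"
    and norm: "quat_norm a b (x0, x1, x2, x3) \<in> padic_nhd P (Suc 0)"
  shows False
proof -
  let ?K = "padic_completion P"
  let ?h = "(+>\<^bsub>C\<^esub>) N"
  interpret h: ring_hom_cring C ?K ?h by (rule padic_completion_hom)
  obtain s where s: "s \<in> carrier C" "\<And>n. s n \<in> padic_nhd P (Suc 0)"
    "(\<lambda>n. s n * s n - s n + quat_norm a b (x0, x1, x2, x3)) \<in> N"
    using hensel_sequence[OF norm] by blast
  define t where "t = (\<lambda>n. x0 - s n)"
  define e where "e x = (\<lambda>_::nat. x)" for x :: 'k
  have eC: "e x \<in> carrier C" for x by (simp add: e_def const_in_C)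
  have tC: "t \<in> carrier C"
    using add_in_C[OF const_in_C[of x0] minus_in_C[OF s(1)]] by (simp add: t_def)
  note inC = eC tC C.m_closed C.a_closed C.a_inv_closed
  have "x0 * 2 = 1" using tr by (simp add: mult.commute)
  then have x0s: "x0 * z + x0 * z = z" for z
    by (metis distrib_left mult.left_commute mult.right_neutral mult_2 mult.commute)
  define M where "M = t \<otimes>\<^bsub>C\<^esub> t \<oplus>\<^bsub>C\<^esub> \<ominus>\<^bsub>C\<^esub> (e a \<otimes>\<^bsub>C\<^esub> (e x1 \<otimes>\<^bsub>C\<^esub> e x1)) \<oplus>\<^bsub>C\<^esub> \<ominus>\<^bsub>C\<^esub> (e b \<otimes>\<^bsub>C\<^esub> (e x2 \<otimes>\<^bsub>C\<^esub> e x2))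
    \<oplus>\<^bsub>C\<^esub> (e a \<otimes>\<^bsub>C\<^esub> e b) \<otimes>\<^bsub>C\<^esub> (e x3 \<otimes>\<^bsub>C\<^esub> e x3)"
  have MC: "M \<in> carrier C" unfolding M_def by (intro inC)
  have "(x0 - z) * (x0 - z) = x0 * x0 + z * z - z" for z
    using x0s[of z] by (simp add: algebra_simps)
  then have "M = (\<lambda>n. s n * s n - s n + quat_norm a b (x0, x1, x2, x3))"
    unfolding M_def using minus_C[OF C.m_closed[OF eC C.m_closed[OF eC eC]]]
    by (simp add: e_def t_def quat_norm_def fun_eq_iff)
  then have "?h M = \<zero>\<^bsub>?K\<^esub>" using coset_zero_iff[OF MC] s(3) by simp
  then have null: "?h t \<otimes>\<^bsub>?K\<^esub> ?h t \<oplus>\<^bsub>?K\<^esub> \<ominus>\<^bsub>?K\<^esub> (?h (e a) \<otimes>\<^bsub>?K\<^esub> (?h (e x1) \<otimes>\<^bsub>?K\<^esub> ?h (e x1)))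
     \<oplus>\<^bsub>?K\<^esub> \<ominus>\<^bsub>?K\<^esub> (?h (e b) \<otimes>\<^bsub>?K\<^esub> (?h (e x2) \<otimes>\<^bsub>?K\<^esub> ?h (e x2)))
     \<oplus>\<^bsub>?K\<^esub> (?h (e a) \<otimes>\<^bsub>?K\<^esub> ?h (e b)) \<otimes>\<^bsub>?K\<^esub> (?h (e x3) \<otimes>\<^bsub>?K\<^esub> ?h (e x3)) = \<zero>\<^bsub>?K\<^esub>"
    unfolding M_def by (simp only: h.hom_mult h.hom_add h.hom_a_inv inC)
  have div: "division_ring (quaternion_algebra ?K (?h (e a)) (?h (e b)))"
    using ram by (simp add: Ram_f_def padic_embed_def e_def)
  have "?h t = \<zero>\<^bsub>?K\<^esub>"
    by (rule division_quaternion_anisotropic[OF h.S.cring_axioms div _ _ _ _ _ _ null])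
       (simp_all only: h.hom_closed inC)
  then have "t \<in> N" using coset_zero_iff[OF tC] by simp
  then obtain i where "x0 - s i \<in> padic_nhd P (Suc 0)"
    unfolding mem_N_iff t_def by blast
  then have x0: "x0 \<in> padic_nhd P (Suc 0)" using nhd_add[OF _ s(2)[of i]] by fastforce
  have "1 \<in> padic_nhd P (Suc 0)" using nhd_add[OF x0 x0] tr by simp
  then show False using one_notin_nhd by blast
qed

text \<open>
  This bounds the different of the local maximal order.  Dividing by a nonintegral trace \<open>t\<close> gives
  trace 1 and divides the norm by \<open>t\<^sup>2\<close>, which raises its valuation by at least 2, from at least
  \<open>-1\<close> to a positive value.
\<close>

lemma ramified_trace_integral:
  assumes ram: "P \<in> Ram_f a b"
    and norm: "p * quat_norm a b (x0, x1, x2, x3) \<in> L"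
  shows "2 * x0 \<in> L"
proof (rule ccontr)
  assume not: "2 * x0 \<notin> L"
  then obtain y where y: "y \<in> L" "1 / (2 * x0) = p * y" using inverse_in_pL by blast
  define t where "t = 1 / (2 * x0)"
  have x0: "x0 \<noteq> 0" using not int_in_L[of 0] by auto
  show False
  proof (rule ramified_no_split_polynomial[OF ram])
    show "2 * (t * x0) = 1" using x0 by (simp add: t_def)
    have "quat_norm a b (t * x0, t * x1, t * x2, t * x3) = t * t * quat_norm a b (x0, x1, x2, x3)"
      by (simp add: quat_norm_def algebra_simps)
    also have "\<dots> = p ^ Suc 0 * (y * y * (p * quat_norm a b (x0, x1, x2, x3)))"
      unfolding t_def y(2) by (simp add: mult_ac)
    finally show "quat_norm a b (t * x0, t * x1, t * x2, t * x3) \<in> padic_nhd P (Suc 0)"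
      by (intro nhdI[OF L_mult[OF L_mult[OF y(1) y(1)] norm]])
  qed
qed

end

section \<open>Finiteness of residue fields and of the set of ramified primes\<close>

text \<open>
  Common factors \<open>q\<close> of all coefficients can be cancelled, so some relation is nontrivial modulo \<open>q\<close>.
\<close>

lemma primitive_relation:
  fixes f :: "nat \<Rightarrow> 'k::field_char_0" and q :: int
  assumes q: "q > 1" and c: "i0 \<le> n" "c i0 \<noteq> 0" "(\<Sum>i\<le>n. of_int (c i) * f i) = 0"
  shows "\<exists>c. (\<exists>i\<le>n. \<not> q dvd c i) \<and> (\<Sum>i\<le>n. of_int (c i) * f i) = 0"
  using c
proof (induction "nat \<bar>c i0\<bar>" arbitrary: c rule: less_induct)
  case less
  show ?case
  proof (cases "\<exists>i\<le>n. \<not> q dvd c i")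
    case True
    then show ?thesis using less.prems by blast
  next
    case False
    define c' where "c' i = c i div q" for i
    have c': "c i = q * c' i" if "i \<le> n" for i using False that by (simp add: c'_def)
    have nz: "c' i0 \<noteq> 0" using less.prems c' by fastforce
    have "\<bar>c' i0\<bar> * 1 < \<bar>c' i0\<bar> * q" using nz q by (intro mult_strict_left_mono) auto
    then have "nat \<bar>c' i0\<bar> < nat \<bar>c i0\<bar>"
      using c'[OF less.prems(1)] q nz by (simp add: abs_mult mult.commute)
    moreover have "of_int q * (\<Sum>i\<le>n. of_int (c' i) * f i) = (\<Sum>i\<le>n. of_int (c i) * f i)"
      unfolding sum_distrib_left
    proof (rule sum.cong[OF refl])
      fix i assume "i \<in> {..n}"
      then have "c i = q * c' i" using c' by blast
      then show "of_int q * (of_int (c' i) * f i) = of_int (c i) * f i"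
        by (simp only: of_int_mult mult.assoc)
    qed
    then have "(\<Sum>i\<le>n. of_int (c' i) * f i) = 0" using q unfolding less.prems(3) by simp
    ultimately show ?thesis by (intro less.hyps[of c'] less.prems(1) nz)
  qed
qed

text \<open>
  Modulo \<open>q\<close>, the algebraic integers form a vector space over the field with \<open>q\<close> elements.  A relation
  that is primitive at \<open>q\<close> remains nontrivial modulo \<open>q\<close>, so this space has finite dimension; the
  combinations of a maximal independent sequence \<open>f\<close>, with coefficients in \<open>{0..<q}\<close>, represent
  all classes.
\<close>

lemma finite_residues_mod_prime_number:
  assumes nf: "number_field TYPE('k::field_char_0)" and q: "normalization_semidom_class.prime (q::int)"
  shows "\<exists>T :: 'k set. finite T \<and> (\<forall>t\<in>T. algebraic_int t) \<and>
    (\<forall>x. algebraic_int x \<longrightarrow> (\<exists>t\<in>T. \<exists>y. algebraic_int y \<and> x - t = of_int q * y))"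
proof -
  define D where "D x \<longleftrightarrow> (\<exists>y. algebraic_int y \<and> x = of_int q * y)" for x :: 'k
  have D_add: "D (x + y)" if "D x" "D y" for x y
    using that unfolding D_def by (metis algebraic_int_add distrib_left)
  have D_mult: "D (of_int z * x)" if "D x" for x z
    using that unfolding D_def by (metis algebraic_int_mult algebraic_int_of_int mult.left_commute)
  have D_q: "D (of_int (q * z) * x)" if "algebraic_int x" for x z
    unfolding D_def of_int_mult mult.assoc
    using algebraic_int_mult[OF algebraic_int_of_int that] by blast
  have D_sum: "D (\<Sum>i<m. h i)" if "\<And>i. i < m \<Longrightarrow> D (h i)" for m and h :: "nat \<Rightarrow> 'k"
    using that
  proof (induction m)
    case 0
    then show ?case by (auto simp: D_def intro!: exI[of _ 0])
  next
    case (Suc m)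
    then show ?case using D_add[of "\<Sum>i<m. h i" "h m"] by simp
  qed
  define indep where "indep m f \<longleftrightarrow> (\<forall>i<m. algebraic_int (f i)) \<and>
     (\<forall>c. D (\<Sum>i<m. of_int (c i) * f i) \<longrightarrow> (\<forall>i<m. q dvd c i))" for m :: nat and f :: "nat \<Rightarrow> 'k"
  obtain n where n: "\<And>f :: nat \<Rightarrow> 'k. \<exists>c :: nat \<Rightarrow> int. (\<exists>i\<le>n. c i \<noteq> 0) \<and> (\<Sum>i\<le>n. of_int (c i) * f i) = 0"
    using number_field_int_relation[OF nf] by blast
  have q1: "q > 1" using q prime_gt_1_int by blast
  have bound: "m \<le> n" if "indep m f" for m f
  proof (rule ccontr)
    assume m: "\<not> m \<le> n"
    obtain c where c: "\<exists>i\<le>n. \<not> q dvd c i" "(\<Sum>i\<le>n. of_int (c i) * f i) = 0"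
      using n[of f] primitive_relation[OF q1] by blast
    define c' where "c' i = (if i \<le> n then c i else 0)" for i
    have "(\<Sum>i<m. of_int (c' i) * f i) = (\<Sum>i\<le>n. of_int (c' i) * f i)"
      using m by (intro sum.mono_neutral_right) (auto simp: c'_def)
    also have "\<dots> = 0" using c(2) by (simp add: c'_def)
    finally have "D (\<Sum>i<m. of_int (c' i) * f i)" by (auto simp: D_def intro!: exI[of _ 0])
    then have "\<forall>i<m. q dvd c' i" using that unfolding indep_def by blast
    moreover obtain i where i: "i \<le> n" "\<not> q dvd c i" using c(1) by blast
    ultimately have "q dvd c' i" using m by simp
    then show False using i by (simp add: c'_def)
  qed
  have ex0: "\<exists>f. indep 0 f" by (simp add: indep_def)
  define m where "m = (GREATEST m. \<exists>f. indep m f)"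
  have "\<exists>f. indep m f"
    unfolding m_def by (rule GreatestI_nat[of _ 0 n]) (use ex0 bound in auto)
  then obtain f where f: "indep m f" by blast
  have max: "\<not> indep (Suc m) g" for g
  proof
    assume "indep (Suc m) g"
    then have "Suc m \<le> m"
      unfolding m_def by (intro Greatest_le_nat[of _ _ n]) (use bound in blast)+
    then show False by simp
  qed
  define T where "T = (\<lambda>d. \<Sum>i<m. of_int (d i) * f i) ` PiE {..<m} (\<lambda>_. {0..<q})"
  have "finite T" unfolding T_def by (intro finite_imageI finite_PiE) auto
  moreover have sum_int: "algebraic_int (\<Sum>i<l. of_int (d i) * f i)" if "l \<le> m" for d :: "nat \<Rightarrow> int" and l
    using that f by (induction l) (auto simp: indep_def intro!: algebraic_int_add algebraic_int_mult)
  then have "\<forall>t\<in>T. algebraic_int t" by (auto simp: T_def)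
  moreover have "\<exists>t\<in>T. D (x - t)" if x: "algebraic_int x" for x
  proof -
    \<comment> \<open>Appending \<open>x\<close> to the maximal independent sequence creates a relation in which \<open>x\<close> has a
        coefficient invertible modulo \<open>q\<close>; it is solved for \<open>x\<close>.\<close>
    define g where "g = f(m := x)"
    have "\<forall>i<Suc m. algebraic_int (g i)" using f x by (auto simp: g_def indep_def)
    then obtain c where c: "D (\<Sum>i<Suc m. of_int (c i) * g i)" "\<exists>i<Suc m. \<not> q dvd c i"
      using max[of g] unfolding indep_def by blast
    have g: "(\<Sum>i<Suc m. of_int (c i) * g i) = (\<Sum>i<m. of_int (c i) * f i) + of_int (c m) * x"
      by (simp add: g_def)
    have "\<not> q dvd c m"
    proof
      assume "q dvd c m"
      then obtain z where "c m = q * z" by blast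
      then have "D (- (of_int (c m) * x))" using D_q[of x "- z"] x by simp
      then have "D (\<Sum>i<m. of_int (c i) * f i)" using D_add[OF c(1)] unfolding g by fastforce
      then have "\<forall>i<m. q dvd c i" using f unfolding indep_def by blast
      then show False using c(2) \<open>q dvd c m\<close> less_Suc_eq by blast
    qed
    then have "coprime (c m) q" using q prime_imp_coprime coprime_commute by blast
    then obtain u v where uv: "u * c m + v * q = 1" by (metis bezout_int coprime_imp_gcd_eq_1)
    define d where "d i = (if i < m then (- u * c i) mod q else undefined)" for i
    have dT: "(\<Sum>i<m. of_int (d i) * f i) \<in> T"
      unfolding T_def by (rule imageI) (use q1 in \<open>auto simp: d_def PiE_iff extensional_def\<close>)
    have "D (of_int u * (\<Sum>i<Suc m. of_int (c i) * g i))" by (rule D_mult[OF c(1)])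
    moreover have "D (of_int (q * v) * x)" by (rule D_q[OF x])
    moreover have "D (\<Sum>i<m. of_int (- u * c i - d i) * f i)"
    proof (rule D_sum)
      fix i assume i: "i < m"
      have "- u * c i - d i = q * ((- u * c i) div q)"
        using i by (simp add: d_def minus_mod_eq_mult_div)
      then show "D (of_int (- u * c i - d i) * f i)"
        using D_q[of "f i" "(- u * c i) div q"] i f by (simp only: indep_def)
    qed
    ultimately have total: "D ((of_int u * (\<Sum>i<Suc m. of_int (c i) * g i) + of_int (q * v) * x)
        + (\<Sum>i<m. of_int (- u * c i - d i) * f i))" by (intro D_add)
    have split: "(\<Sum>i<m. of_int (- u * c i - d i) * f i) =
        - (of_int u * (\<Sum>i<m. of_int (c i) * f i)) - (\<Sum>i<m. of_int (d i) * f i)"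
      by (simp add: sum_distrib_left algebra_simps sum_subtractf sum_negf)
    have inverse: "of_int u * (of_int (c m) * x) + of_int (q * v) * x = x"
    proof -
      have "of_int u * (of_int (c m) * x) + of_int (q * v) * x = of_int (u * c m + v * q) * x"
        by (simp add: algebra_simps)
      then show ?thesis by (simp add: uv)
    qed
    have collect: "(v * (A + y) + z) + E = w - B" if "E = - (v * A) - B" "v * y + z = w" for v A y z E B w :: 'k
      using that by (simp add: that(2)[symmetric] distrib_left)
    have "D (x - (\<Sum>i<m. of_int (d i) * f i))"
      using total unfolding g collect[OF split inverse] .
    then show ?thesis using dT by blast
  qed
  ultimately show ?thesis unfolding D_def by blast
qed

context prime_with_generator
begin

lemma contains_prime_number:
  obtains q :: int where "normalization_semidom_class.prime q" "of_int q \<in> P"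
proof -
  obtain c :: int where c: "c \<noteq> 0" "algebraic_int (of_int c * (1 / p))"
    using number_field_integer_denominator[OF number_field] by blast
  have "of_int c = p * (of_int c * (1 / p))" using p_nonzero by simp
  then have cP: "of_int c \<in> P" using c(2) mem_P_iff by blast
  have "\<exists>q. normalization_semidom_class.prime q \<and> of_int q \<in> P" if "z \<noteq> 0" "of_int z \<in> P" for z :: int
    using that
  proof (induction z rule: prime_divisors_induct)
    case zero
    then show ?case by simp
  next
    case (unit z)
    then have "z dvd 1" by simp
    then obtain y where "1 = z * y" by blast
    then have "(1 :: 'k) = of_int z * of_int y" by (metis of_int_1 of_int_mult)
    then show ?case using P_mult[OF unit.prems(2), of "of_int y"] one_notin_P by simp
  next
    case (factor q z)
    then show ?case using P_prime[of "of_int q" "of_int z"] by auto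
  qed
  then show thesis using that c(1) cP by blast
qed

lemma finite_residues:
  obtains T where "finite T" "\<And>t. t \<in> T \<Longrightarrow> algebraic_int t" "\<And>x. algebraic_int x \<Longrightarrow> \<exists>t\<in>T. x - t \<in> P"
proof -
  obtain q :: int where q: "normalization_semidom_class.prime q" "of_int q \<in> P" using contains_prime_number .
  obtain T :: "'k set" where T: "finite T" "\<forall>t\<in>T. algebraic_int t"
    "\<forall>x. algebraic_int x \<longrightarrow> (\<exists>t\<in>T. \<exists>y. algebraic_int y \<and> x - t = of_int q * y)"
    using finite_residues_mod_prime_number[OF number_field q(1)] by blast
  show thesis
    by (rule that[of T]) (use T q(2) P_mult in \<open>metis\<close>)+
qed

definition residue_class :: "'k \<Rightarrow> 'k set" where
  "residue_class x = {y. y - x \<in> P}"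

abbreviation residue_field :: "'k set set" where
  "residue_field \<equiv> residue_class ` {x. algebraic_int x}"

lemma residue_class_eq_iff: "residue_class x = residue_class y \<longleftrightarrow> x - y \<in> P"
proof
  assume "residue_class x = residue_class y"
  moreover have "x \<in> residue_class x" by (simp add: residue_class_def zero_in_P)
  ultimately show "x - y \<in> P" by (simp add: residue_class_def)
next
  assume xy: "x - y \<in> P"
  have "z - x \<in> P \<longleftrightarrow> z - y \<in> P" for z
    using P_add[OF xy, of "z - x"] P_add[OF P_minus[OF xy], of "z - y"] by auto
  then show "residue_class x = residue_class y" by (simp add: residue_class_def)
qed

lemma finite_residue_field: "finite residue_field"
proof -
  obtain T where T: "finite T" "\<And>t. t \<in> T \<Longrightarrow> algebraic_int t" "\<And>x. algebraic_int x \<Longrightarrow> \<exists>t\<in>T. x - t \<in> P"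
    using finite_residues by blast
  have "residue_field \<subseteq> residue_class ` T"
  proof
    fix c assume "c \<in> residue_field"
    then obtain x where x: "algebraic_int x" "c = residue_class x" by blast
    obtain t where "t \<in> T" "x - t \<in> P" using T(3)[OF x(1)] by blast
    then show "c \<in> residue_class ` T" using x residue_class_eq_iff[of x t] by simp
  qed
  then show ?thesis using T(1) finite_surj by blast
qed

text \<open>
  Modulo \<open>P\<close>, the polynomial \<open>u x\<^sup>2 + v\<close> takes every value at most twice, at \<open>r\<close> and \<open>- r\<close>, and the value
  \<open>v\<close> only once.  Hence it takes more than half of all values.
\<close>

lemma card_quadratic_values:
  assumes u: "algebraic_int u" "u \<notin> P" and v: "algebraic_int v"
  shows "card residue_field < 2 * card ((\<lambda>x. residue_class (u * (x * x) + v)) ` {x. algebraic_int x})"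
proof -
  let ?I = "{x :: 'k. algebraic_int x}"
  define S where "S = (\<lambda>x. residue_class (u * (x * x) + v)) ` ?I"
  have Sfin: "finite S"
    by (rule finite_subset[OF _ finite_residue_field])
       (use u v in \<open>auto simp: S_def intro!: imageI algebraic_int_add algebraic_int_mult\<close>)
  have "\<exists>x. algebraic_int x \<and> residue_class (u * (x * x) + v) = s" if "s \<in> S" for s
    using that by (auto simp: S_def)
  then obtain r where r: "\<And>s. s \<in> S \<Longrightarrow> algebraic_int (r s)"
    "\<And>s. s \<in> S \<Longrightarrow> residue_class (u * (r s * r s) + v) = s" by metis
  have vS: "residue_class v \<in> S" by (auto simp: S_def intro!: image_eqI[of _ _ 0])
  have "residue_field \<subseteq> (\<lambda>s. residue_class (r s)) ` S \<union> (\<lambda>s. residue_class (- r s)) ` (S - {residue_class v})"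
  proof
    fix c assume "c \<in> residue_field"
    then obtain x where x: "algebraic_int x" "c = residue_class x" by blast
    define s where "s = residue_class (u * (x * x) + v)"
    have s: "s \<in> S" using x by (simp add: S_def s_def)
    have "residue_class (u * (x * x) + v) = residue_class (u * (r s * r s) + v)"
      using r(2)[OF s] by (simp add: s_def)
    then have "u * ((x - r s) * (x + r s)) \<in> P"
      unfolding residue_class_eq_iff by (simp add: algebra_simps)
    moreover have int: "algebraic_int (x - r s)" "algebraic_int (x + r s)"
      using algebraic_int_diff[OF x(1) r(1)[OF s]] algebraic_int_add[OF x(1) r(1)[OF s]] .
    ultimately have "(x - r s) * (x + r s) \<in> P"
      using P_prime[OF u(1) algebraic_int_mult[OF int]] u(2) by blast
    then consider "x - r s \<in> P" | "x + r s \<in> P"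
      using P_prime[OF int] by blast
    then show "c \<in> (\<lambda>s. residue_class (r s)) ` S \<union> (\<lambda>s. residue_class (- r s)) ` (S - {residue_class v})"
    proof cases
      case 1
      then show ?thesis using s x residue_class_eq_iff by blast
    next
      case 2
      then have eq: "residue_class x = residue_class (- r s)" by (simp add: residue_class_eq_iff)
      show ?thesis
      proof (cases "s = residue_class v")
        case False
        then show ?thesis using s x eq by blast
      next
        case True
        then have "u * (r s * r s) \<in> P"
          using r(2)[OF s] residue_class_eq_iff[of "u * (r s * r s) + v" v] by simp
        then have "r s * r s \<in> P"
          using P_prime[OF u(1) algebraic_int_mult[OF r(1)[OF s] r(1)[OF s]]] u(2) by blast
        then have "r s \<in> P" using P_prime[OF r(1)[OF s] r(1)[OF s]] by blast
        then have "x - r s \<in> P" using P_add[OF 2 P_minus[OF P_add[of "r s" "r s"]]] by simp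
        then show ?thesis using s x residue_class_eq_iff by blast
      qed
    qed
  qed
  then have "card residue_field \<le> card ((\<lambda>s. residue_class (r s)) ` S \<union> (\<lambda>s. residue_class (- r s)) ` (S - {residue_class v}))"
    using Sfin by (intro card_mono) auto
  also have "\<dots> \<le> card S + card (S - {residue_class v})"
    using Sfin by (intro order.trans[OF card_Un_le] add_mono card_image_le) auto
  also have "\<dots> < 2 * card S"
    using Sfin vS card_Diff1_less[of S "residue_class v"] by linarith
  finally show ?thesis by (simp add: S_def)
qed

text \<open>
  The values of \<open>a x\<^sup>2\<close> and those of \<open>1 - b y\<^sup>2\<close> each make up more than half of the residue field, so the
  two sets of values intersect.
\<close>

lemma conic_solvable_mod_P:
  assumes a: "algebraic_int a" "a \<notin> P" and b: "algebraic_int b" "b \<notin> P"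
  obtains x y where "algebraic_int x" "algebraic_int y" "a * (x * x) + b * (y * y) - 1 \<in> P"
proof -
  let ?I = "{x :: 'k. algebraic_int x}"
  define S where "S = (\<lambda>x. residue_class (a * (x * x) + 0)) ` ?I"
  define T where "T = (\<lambda>y. residue_class (- b * (y * y) + 1)) ` ?I"
  have sub: "S \<subseteq> residue_field" "T \<subseteq> residue_field"
    using a b by (auto simp: S_def T_def intro!: imageI algebraic_int_add algebraic_int_diff algebraic_int_mult)
  have "- b \<notin> P" using b P_minus[of "- b"] by auto
  then have "card residue_field < 2 * card S" "card residue_field < 2 * card T"
    unfolding S_def T_def using a b by (auto intro!: card_quadratic_values simp del: add_0_right mult_minus_left)
  moreover have "card (S \<union> T) \<le> card residue_field"
    using sub finite_residue_field by (intro card_mono) auto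
  moreover have "card (S \<union> T) = card S + card T" if "S \<inter> T = {}"
    using that sub finite_residue_field finite_subset by (metis card_Un_disjoint)
  ultimately have "S \<inter> T \<noteq> {}" by linarith
  then obtain x y where "algebraic_int x" "algebraic_int y"
    "residue_class (a * (x * x) + 0) = residue_class (- b * (y * y) + 1)"
    by (auto simp: S_def T_def)
  then show thesis using that unfolding residue_class_eq_iff by (simp add: algebra_simps)
qed

text \<open>
  A point of the conic modulo \<open>P\<close> gives \<open>1 + x i + y j\<close> of norm divisible by \<open>p\<close>.  After division by \<open>p\<close>
  the norm has valuation at least \<open>-1\<close>, whereas the trace is \<open>2 / p\<close>.
\<close>

lemma ramified_divides_2ab:
  assumes ram: "P \<in> Ram_f a b" and a: "algebraic_int a" and b: "algebraic_int b"
  shows "2 * (a * b) \<in> P"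
proof (rule ccontr)
  assume not: "2 * (a * b) \<notin> P"
  then have "2 \<notin> P" "a \<notin> P" "b \<notin> P"
    using P_mult[of 2 "a * b"] P_mult[of a "2 * b"] P_mult[of b "2 * a"] a b
    by (auto simp: algebraic_int_mult mult_ac)
  then obtain x y where xy: "algebraic_int x" "algebraic_int y" "a * (x * x) + b * (y * y) - 1 \<in> P"
    using conic_solvable_mod_P a b by blast
  then obtain z where z: "algebraic_int z" "a * (x * x) + b * (y * y) - 1 = p * z"
    by (auto simp: mem_P_iff)
  have "p * p * quat_norm a b (1 / p, x / p, y / p, 0) = 1 - a * (x * x) - b * (y * y)"
    using p_nonzero by (simp add: quat_norm_def field_simps)
  also have "\<dots> = p * (- z)" using z(2) by (simp add: algebra_simps)
  finally have "p * (p * quat_norm a b (1 / p, x / p, y / p, 0)) = p * (- z)"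
    by (simp only: mult.assoc)
  then have "p * quat_norm a b (1 / p, x / p, y / p, 0) = - z"
    using p_nonzero by (metis mult_left_cancel)
  then have "p * quat_norm a b (1 / p, x / p, y / p, 0) \<in> L"
    using z(1) by (simp add: int_in_L)
  then have "2 * (1 / p) \<in> L" by (rule ramified_trace_integral[OF ram])
  then have "p * (2 * (1 / p)) \<in> P" using p_nonzero by (intro int_in_pL_imp_in_P) auto
  then show False using \<open>2 \<notin> P\<close> p_nonzero by simp
qed

end

context class_number_one
begin

lemma prime_ideal_with_generator:
  assumes "P \<in> prime_ideals \<R>"
  obtains p where "prime_with_generator P p"
proof -
  obtain p where "algebraic_int p" "PIdl\<^bsub>\<R>\<^esub> p = P" using prime_ideal_generator[OF assms] .
  then have "prime_with_generator P p"
    by unfold_locales (use assms in auto)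
  then show thesis by (rule that)
qed

lemma prime_ideal_maximal:
  assumes "P \<in> prime_ideals \<R>"
  shows "maximalideal P \<R>"
proof -
  obtain p where p: "algebraic_int p" "PIdl\<^bsub>\<R>\<^esub> p = P" using prime_ideal_generator[OF assms] .
  have "p \<noteq> 0" using principal_generator_nonzero[OF assms p(2)] .
  then have "ring_prime\<^bsub>\<R>\<^esub> p"
    using R.primeideal_iff_prime[of p] p assms by (simp add: prime_ideals_def)
  then show ?thesis
    using R.irreducible_imp_maximalideal[of p] R.primeness_condition[of p] p by simp
qed

lemma prime_ideal_subset_imp_eq:
  assumes "P \<in> prime_ideals \<R>" "Q \<in> prime_ideals \<R>" "P \<subseteq> Q"
  shows "P = Q"
proof -
  interpret P: maximalideal P \<R> using prime_ideal_maximal[OF assms(1)] .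
  interpret Q: maximalideal Q \<R> using prime_ideal_maximal[OF assms(2)] .
  show ?thesis
    using P.I_maximal[OF Q.ideal_axioms assms(3)] Q.I_notcarr Q.a_subset by blast
qed

text \<open>
  Each prime containing \<open>m\<close> is generated by one of the irreducible factors of \<open>m\<close>.
\<close>

lemma finite_primes_containing:
  assumes m: "algebraic_int m" "m \<noteq> 0"
  shows "finite {P \<in> prime_ideals \<R>. m \<in> P}"
proof -
  obtain fs where fs: "set fs \<subseteq> carrier (mult_of \<R>)" "wfactors (mult_of \<R>) fs m"
    using R.mult_of.wfactors_exist[of m] m by auto
  have "{P \<in> prime_ideals \<R>. m \<in> P} \<subseteq> (\<lambda>f. PIdl\<^bsub>\<R>\<^esub> f) ` set fs"
  proof
    fix P assume "P \<in> {P \<in> prime_ideals \<R>. m \<in> P}"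
    then have P: "P \<in> prime_ideals \<R>" "m \<in> P" by auto
    interpret P: primeideal P \<R> using P(1) by (simp add: prime_ideals_def)
    have "foldr (\<otimes>\<^bsub>mult_of \<R>\<^esub>) fs \<one>\<^bsub>mult_of \<R>\<^esub> \<sim>\<^bsub>mult_of \<R>\<^esub> m"
      using fs(2) by (simp add: wfactors_def)
    then have "m divides\<^bsub>mult_of \<R>\<^esub> foldr (\<otimes>\<^bsub>mult_of \<R>\<^esub>) fs \<one>\<^bsub>mult_of \<R>\<^esub>"
      by (simp add: associated_def)
    then obtain c where "algebraic_int c" "foldr (\<otimes>\<^bsub>\<R>\<^esub>) fs \<one>\<^bsub>\<R>\<^esub> = m * c"
      by (auto simp: factor_def)
    then have "foldr (\<otimes>\<^bsub>\<R>\<^esub>) fs \<one>\<^bsub>\<R>\<^esub> \<in> P" using P.I_r_closed[OF P(2), of c] by simp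
    then have "\<exists>f\<in>set fs. f \<in> P" using fs(1)
    proof (induction fs)
      case Nil
      then show ?case using P.one_imp_carrier P.I_notcarr by simp
    next
      case (Cons f fs)
      define y where "y = foldr (\<otimes>\<^bsub>\<R>\<^esub>) fs \<one>\<^bsub>\<R>\<^esub>"
      have "y \<in> carrier \<R>"
        unfolding y_def using Cons.prems(2) by (induction fs) (auto intro: algebraic_int_mult)
      moreover have "f \<otimes>\<^bsub>\<R>\<^esub> y \<in> P" using Cons.prems(1) unfolding y_def foldr.simps o_apply .
      ultimately have "f \<in> P \<or> y \<in> P" using P.I_prime[of f y] Cons.prems(2) by auto
      moreover have "\<exists>f\<in>set fs. f \<in> P" if "y \<in> P"
        using Cons.IH[folded y_def, OF that] Cons.prems(2) by simp
      ultimately show ?case by auto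
    qed
    then obtain f where f: "f \<in> set fs" "f \<in> P" by blast
    have fR: "f \<in> carrier \<R> - {\<zero>\<^bsub>\<R>\<^esub>}" using f fs(1) by auto
    have "irreducible (mult_of \<R>) f" using fs(2) f(1) by (simp add: wfactors_def)
    then have "ring_irreducible\<^bsub>\<R>\<^esub> f" using R.ring_irreducibleI'[OF fR] by simp
    then have "maximalideal (PIdl\<^bsub>\<R>\<^esub> f) \<R>" using R.irreducible_imp_maximalideal[of f] fR by simp
    moreover have "PIdl\<^bsub>\<R>\<^esub> f \<subseteq> P" by (rule R.cgenideal_minimal[OF P.ideal_axioms f(2)])
    ultimately have "P = PIdl\<^bsub>\<R>\<^esub> f"
      using maximalideal.I_maximal[OF _ P.ideal_axioms] P.I_notcarr P.a_subset by blast
    then show "P \<in> (\<lambda>f. PIdl\<^bsub>\<R>\<^esub> f) ` set fs" using f(1) by blast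
  qed
  then show ?thesis using finite_surj by blast
qed

text \<open>
  This is what makes \<open>quat_disc\<close> meaningful: over an infinite set, \<open>finprod\<close> would be the unit
  ideal by convention.
\<close>

lemma finite_Ram_f:
  assumes "algebraic_int a" "algebraic_int b" "a * b \<noteq> 0"
  shows "finite (Ram_f a b :: 'k set set)"
proof (rule finite_subset)
  show "Ram_f a b \<subseteq> {P \<in> prime_ideals \<R>. 2 * (a * b) \<in> P}"
  proof
    fix P assume P: "P \<in> Ram_f a b"
    then have "P \<in> prime_ideals \<R>" by (simp add: Ram_f_def)
    moreover obtain p where "prime_with_generator P p"
      using prime_ideal_with_generator[OF \<open>P \<in> prime_ideals \<R>\<close>] .
    ultimately show "P \<in> {P \<in> prime_ideals \<R>. 2 * (a * b) \<in> P}"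
      using prime_with_generator.ramified_divides_2ab[OF _ P assms(1,2)] by blast
  qed
  show "finite {P \<in> prime_ideals \<R>. 2 * (a * b) \<in> P}"
    using assms by (intro finite_primes_containing) (auto intro: algebraic_int_mult)
qed

end

section \<open>Divisibility of ideals and the local-global principle\<close>

context class_number_one
begin

text \<open>
  The denominators of \<open>x\<close> form an ideal that is contained in no prime ideal.
\<close>

lemma local_global_integral:
  fixes x :: 'k
  assumes "\<And>P. P \<in> prime_ideals \<R> \<Longrightarrow> x \<in> local_ring P"
  shows "algebraic_int x"
proof -
  define I where "I = {d. algebraic_int d \<and> algebraic_int (d * x)}"
  have "ideal I \<R>"
  proof (rule idealI)
    show "ring \<R>" by (rule R.ring_axioms)
    have "\<ominus>\<^bsub>\<R>\<^esub> d = - d" if "algebraic_int d" for d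
      by (rule R.minus_equality) (use that in auto)
    then have "\<ominus>\<^bsub>\<R>\<^esub> d \<in> I" if "d \<in> I" for d using that by (simp add: I_def)
    moreover have "I \<subseteq> carrier \<R>" "0 \<in> I" by (auto simp: I_def)
    moreover have "c \<oplus>\<^bsub>\<R>\<^esub> d \<in> I" if "c \<in> I" "d \<in> I" for c d
      using that by (simp add: I_def algebraic_int_add distrib_right)
    ultimately show "subgroup I (add_monoid \<R>)"
      by (intro R.add.subgroupI) (auto simp: a_inv_def)
    show "y \<otimes>\<^bsub>\<R>\<^esub> d \<in> I" "d \<otimes>\<^bsub>\<R>\<^esub> y \<in> I" if "d \<in> I" "y \<in> carrier \<R>" for d y
      using that algebraic_int_mult[of y "d * x"] algebraic_int_mult[of y d]
      by (auto simp: I_def mult_ac)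
  qed
  then obtain g where g: "algebraic_int g" "I = PIdl\<^bsub>\<R>\<^esub> g" using R.exists_gen[of I] by auto
  show ?thesis
  proof (cases "g \<in> Units \<R>")
    case True
    then have "I = carrier \<R>" using R.ideal_eq_carrier_iff[of g] g by simp
    then have "1 \<in> I" by simp
    then show ?thesis by (simp add: I_def)
  next
    case False
    obtain d where "d \<noteq> 0" "d \<in> I" using fraction[of x] by (auto simp: I_def)
    then have "g \<noteq> 0" unfolding g(2) by (auto simp: cgenideal_ring_of_integers)
    then have "g \<in> carrier \<R> - {\<zero>\<^bsub>\<R>\<^esub>}" using g(1) by simp
    from R.exists_irreducible_divisor[OF this False]
    obtain f where f: "f \<in> carrier \<R>" "ring_irreducible\<^bsub>\<R>\<^esub> f" "f divides\<^bsub>\<R>\<^esub> g"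
      by metis
    have f0: "f \<noteq> 0" using R.ring_irreducibleE(1)[OF f(1,2)] by simp
    define P where "P = PIdl\<^bsub>\<R>\<^esub> f"
    have "primeideal P \<R>"
      using R.maximalideal_prime[OF R.irreducible_imp_maximalideal[OF f(1,2)]] by (simp add: P_def)
    moreover have "f \<in> P" using R.cgenideal_self[OF f(1)] by (simp add: P_def)
    then have "P \<noteq> {0}" using f0 by blast
    ultimately have "x \<in> local_ring P" using assms by (simp add: prime_ideals_def)
    then obtain u w where uw: "algebraic_int u" "algebraic_int w" "w \<notin> P" "x = u / w"
      by (auto simp: local_ring_def)
    have "0 \<in> P" by (auto simp: P_def cgenideal_ring_of_integers intro!: exI[of _ 0])
    then have "w \<noteq> 0" using uw(3) by auto
    then have "w \<in> I" using uw by (simp add: I_def)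
    moreover have "I \<subseteq> P" using f g R.to_contain_is_to_divide[of f g] by (simp add: P_def)
    ultimately show ?thesis using uw(3) by blast
  qed
qed

text \<open>
  At a prime where \<open>x\<close> is not integral, \<open>e\<close> would be divisible by all powers of the uniformizer.
\<close>

lemma completely_integrally_closed:
  fixes e x :: 'k
  assumes e: "algebraic_int e" "e \<noteq> 0" and pow: "\<And>n. algebraic_int (e * x ^ n)"
  shows "algebraic_int x"
proof (rule local_global_integral)
  fix P assume P: "P \<in> prime_ideals \<R>"
  then obtain p where "prime_with_generator P p" using prime_ideal_with_generator by blast
  then interpret prime_with_generator k P p .
  show "x \<in> L"
  proof (rule ccontr)
    assume "x \<notin> L"
    then obtain y where y: "y \<in> L" "1 / x = p * y" using inverse_in_pL by blast
    have x0: "x \<noteq> 0" using \<open>x \<notin> L\<close> int_in_L[of 0] by auto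
    obtain n w where w: "algebraic_int w" "w \<notin> P" "e = p ^ n * w"
      using prime_power_decomposition[OF e] by blast
    have "e = (1 / x) ^ Suc n * (e * x ^ Suc n)" using x0 by (simp add: power_one_over)
    also have "\<dots> = p ^ n * (p * (y ^ Suc n * (e * x ^ Suc n)))"
      unfolding y(2) by (simp add: power_mult_distrib mult_ac)
    finally have "w = p * (y ^ Suc n * (e * x ^ Suc n))" using w(3) p_nonzero by simp
    moreover have "y ^ Suc n * (e * x ^ Suc n) \<in> L" by (intro L_mult[OF L_power[OF y(1)]] int_in_L pow)
    ultimately have "w \<in> P" using int_in_pL_imp_in_P[of "y ^ Suc n * (e * x ^ Suc n)"] w(1) by metis
    then show False using w(2) by blast
  qed
qed

text \<open>
  To contain is to divide, since all ideals are principal.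
\<close>

lemma ideal_divides_iff:
  assumes I: "ideal I \<R>" and J: "ideal J \<R>"
  shows "I divides\<^bsub>ideals_set \<R>\<^esub> J \<longleftrightarrow> J \<subseteq> I"
proof
  assume "I divides\<^bsub>ideals_set \<R>\<^esub> J"
  then obtain H where "ideal H \<R>" "J = I \<cdot>\<^bsub>\<R>\<^esub> H" by (auto simp: factor_def ideals_set_def)
  then show "J \<subseteq> I" using R.ideal_prod_inter[OF I] by auto
next
  assume sub: "J \<subseteq> I"
  obtain i where i: "i \<in> carrier \<R>" "I = PIdl\<^bsub>\<R>\<^esub> i" using R.exists_gen[OF I] by blast
  obtain j where j: "j \<in> carrier \<R>" "J = PIdl\<^bsub>\<R>\<^esub> j" using R.exists_gen[OF J] by blast
  have "j \<in> I" using sub R.cgenideal_self[OF j(1)] j(2) by blast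
  then obtain c where c: "algebraic_int c" "j = c * i" by (auto simp: i cgenideal_ring_of_integers)
  have cid: "ideal (PIdl\<^bsub>\<R>\<^esub> c) \<R>" using c by (intro R.cgenideal_ideal) simp
  have "J = I \<cdot>\<^bsub>\<R>\<^esub> (PIdl\<^bsub>\<R>\<^esub> c)"
  proof
    show "J \<subseteq> I \<cdot>\<^bsub>\<R>\<^esub> (PIdl\<^bsub>\<R>\<^esub> c)"
    proof
      fix x assume "x \<in> J"
      then obtain y where y: "algebraic_int y" "x = y * j" by (auto simp: j cgenideal_ring_of_integers)
      have "i \<otimes>\<^bsub>\<R>\<^esub> (y * c) \<in> I \<cdot>\<^bsub>\<R>\<^esub> (PIdl\<^bsub>\<R>\<^esub> c)"
        by (rule ideal_prod.prod)
           (use i R.cgenideal_self[OF i(1)] y in \<open>auto simp: cgenideal_ring_of_integers\<close>)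
      then show "x \<in> I \<cdot>\<^bsub>\<R>\<^esub> (PIdl\<^bsub>\<R>\<^esub> c)" using y c by (simp add: mult_ac)
    qed
    show "I \<cdot>\<^bsub>\<R>\<^esub> (PIdl\<^bsub>\<R>\<^esub> c) \<subseteq> J"
    proof
      fix x assume "x \<in> I \<cdot>\<^bsub>\<R>\<^esub> (PIdl\<^bsub>\<R>\<^esub> c)"
      then show "x \<in> J"
      proof induction
        case (prod s t)
        then obtain y z where yz: "algebraic_int y" "algebraic_int z" "s = y * i" "t = z * c"
          by (auto simp: i cgenideal_ring_of_integers)
        then have "s * t = (y * z) * j" by (simp add: c(2) mult_ac)
        then show ?case
          using algebraic_int_mult[OF yz(1,2)] unfolding j(2) cgenideal_ring_of_integers by auto
      next
        case (sum s t)
        then show ?case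
          using additive_subgroup.a_closed[OF ideal.axioms(1)[OF J]] by blast
      qed
    qed
  qed
  then show "I divides\<^bsub>ideals_set \<R>\<^esub> J"
    using cid by (auto simp: factor_def ideals_set_def)
qed

lemma principal_subset_iff:
  assumes "ideal I \<R>" "algebraic_int m"
  shows "PIdl\<^bsub>\<R>\<^esub> m \<subseteq> I \<longleftrightarrow> m \<in> I"
  using R.cgenideal_minimal[OF assms(1)] R.cgenideal_self[of m] assms(2) by auto

lemma divides_principal_iff:
  assumes "ideal I \<R>" "algebraic_int m"
  shows "I divides\<^bsub>ideals_set \<R>\<^esub> PIdl\<^bsub>\<R>\<^esub> m \<longleftrightarrow> m \<in> I"
  using ideal_divides_iff[OF assms(1) R.cgenideal_ideal[of m]] principal_subset_iff[OF assms] assms(2)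
  by simp

lemma prime_ideal_prod_subset:
  assumes P: "primeideal P \<R>" and I: "ideal I \<R>" and J: "ideal J \<R>"
    and sub: "I \<cdot>\<^bsub>\<R>\<^esub> J \<subseteq> P"
  shows "I \<subseteq> P \<or> J \<subseteq> P"
proof (rule ccontr)
  assume "\<not> ?thesis"
  then obtain i j where ij: "i \<in> I" "i \<notin> P" "j \<in> J" "j \<notin> P" by blast
  have "i \<otimes>\<^bsub>\<R>\<^esub> j \<in> P" using ideal_prod.prod[OF ij(1,3)] sub by blast
  then show False
    using primeideal.I_prime[OF P] ideal.Icarr[OF I ij(1)] ideal.Icarr[OF J ij(3)] ij by blast
qed

text \<open>
  A prime ideal containing a product contains a factor, and nonzero prime ideals are maximal.
\<close>

lemma product_of_primes_subset_iff:
  assumes "finite F" "F \<subseteq> prime_ideals \<R>" and P: "P \<in> prime_ideals \<R>"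
  shows "ideal (finprod (ideals_set \<R>) (\<lambda>Q. Q) F) \<R> \<and>
    (finprod (ideals_set \<R>) (\<lambda>Q. Q) F \<subseteq> P \<longleftrightarrow> P \<in> F)"
  using assms(1,2)
proof (induction F rule: finite_induct)
  case empty
  interpret P: primeideal P \<R> using P by (simp add: prime_ideals_def)
  have "\<not> carrier \<R> \<subseteq> P" using P.I_notcarr P.a_subset by blast
  then show ?case using R.oneideal
    by (simp add: comm_monoid.finprod_empty[OF R.ideals_set_is_comm_monoid])
       (simp add: ideals_set_def)
next
  case (insert Q F)
  interpret M: Group.comm_monoid "ideals_set \<R>" by (rule R.ideals_set_is_comm_monoid)
  have prime: "primeideal P \<R>" using P by (simp add: prime_ideals_def)
  have ids: "ideal Q' \<R>" if "Q' \<in> insert Q F" for Q'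
    using that insert.prems by (auto simp: prime_ideals_def primeideal_def)
  define J where "J = finprod (ideals_set \<R>) (\<lambda>Q. Q) F"
  have J: "ideal J \<R>" "J \<subseteq> P \<longleftrightarrow> P \<in> F" using insert by (auto simp: J_def)
  have "finprod (ideals_set \<R>) (\<lambda>Q. Q) (insert Q F) = Q \<otimes>\<^bsub>ideals_set \<R>\<^esub> J"
    unfolding J_def by (rule M.finprod_insert) (use insert ids in \<open>auto simp: ideals_set_def\<close>)
  then have eq: "finprod (ideals_set \<R>) (\<lambda>Q. Q) (insert Q F) = Q \<cdot>\<^bsub>\<R>\<^esub> J"
    by (simp add: ideals_set_def)
  have Q: "ideal Q \<R>" using ids by blast
  have "Q \<cdot>\<^bsub>\<R>\<^esub> J \<subseteq> P \<longleftrightarrow> Q \<subseteq> P \<or> J \<subseteq> P"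
    using prime_ideal_prod_subset[OF prime Q J(1)] R.ideal_prod_inter[OF Q J(1)] by blast
  moreover have "Q \<subseteq> P \<longleftrightarrow> P = Q"
    using prime_ideal_subset_imp_eq[of Q P] P insert.prems by auto
  ultimately show ?case unfolding eq using R.ideal_prod_is_ideal[OF Q J(1)] J(2) by blast
qed

lemma divides_quat_disc_iff:
  assumes "finite (Ram_f a b)" "P \<in> prime_ideals \<R>"
  shows "P divides\<^bsub>ideals_set \<R>\<^esub> quat_disc a b \<longleftrightarrow> P \<in> Ram_f a b"
proof -
  have "Ram_f a b \<subseteq> prime_ideals \<R>" by (auto simp: Ram_f_def)
  then show ?thesis
    using product_of_primes_subset_iff[OF assms(1) _ assms(2)] assms(2)
      ideal_divides_iff[of P "quat_disc a b"]
    by (simp add: quat_disc_def prime_ideals_def primeideal_def)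
qed

end

section \<open>Orders in a quaternion algebra\<close>

lemma type_algebra_simps [simp]:
  "carrier (ring_of_type_algebra :: 'k::field ring) = UNIV"
  "x \<otimes>\<^bsub>ring_of_type_algebra\<^esub> y = x * y"
  "x \<oplus>\<^bsub>ring_of_type_algebra\<^esub> y = x + y"
  "\<one>\<^bsub>ring_of_type_algebra\<^esub> = (1 :: 'k)"
  "\<zero>\<^bsub>ring_of_type_algebra\<^esub> = (0 :: 'k)"
  by (simp_all add: ring_of_type_algebra_def)

lemma type_algebra_minus [simp]:
  "x \<ominus>\<^bsub>ring_of_type_algebra\<^esub> y = x - (y :: 'k::field)"
proof -
  interpret K: cring "ring_of_type_algebra :: 'k ring" by (rule cring_from_type_algebra)
  have "\<ominus>\<^bsub>ring_of_type_algebra\<^esub> y = - y" by (rule K.minus_equality) auto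
  then show ?thesis by (simp add: a_minus_def)
qed

lemma quat_alg_simps [simp]:
  "carrier (quat_alg a b) = (UNIV :: 'k::field_char_0 quad set)"
  "x \<otimes>\<^bsub>quat_alg a b\<^esub> y = quat_mult ring_of_type_algebra a b x y"
  "x \<oplus>\<^bsub>quat_alg a b\<^esub> y = quat_add ring_of_type_algebra x y"
  "\<one>\<^bsub>quat_alg a b\<^esub> = (1, 0, 0, 0)"
  "\<zero>\<^bsub>quat_alg a b\<^esub> = (0, 0, 0, 0)"
  by (simp_all add: quaternion_algebra_def quat_scalar_def)

lemma ring_quat_alg: "ring (quat_alg a (b :: 'k::field_char_0))"
  by (rule cring.quaternion_algebra_ring[OF cring_from_type_algebra]) auto

lemma quat_norm_mult:
  "quat_norm a b (quat_mult ring_of_type_algebra a b x y) = quat_norm a b x * quat_norm a (b :: 'k::field_char_0) y"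
  by (cases x; cases y) (simp add: quat_norm_def algebra_simps)

definition integral_quad :: "'k::field_char_0 quad set" where
  "integral_quad = {(x0, x1, x2, x3). algebraic_int x0 \<and> algebraic_int x1 \<and> algebraic_int x2 \<and> algebraic_int x3}"

definition quad_scale :: "'k::field_char_0 \<Rightarrow> 'k quad \<Rightarrow> 'k quad" where
  "quad_scale d = (\<lambda>(x0, x1, x2, x3). (d * x0, d * x1, d * x2, d * x3))"

lemma span_R_Nil: "span_R a b [] = {(0, 0, 0, 0 :: 'k::field_char_0)}"
  by (simp add: span_R_def ring.Span.simps[OF ring_quat_alg])

lemma span_R_Cons:
  "x \<in> span_R a b (u # us) \<longleftrightarrow>
    (\<exists>c v. algebraic_int (c :: 'k::field_char_0) \<and> v \<in> span_R a b us \<and>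
      x = quat_add ring_of_type_algebra (quad_scale c u) v)"
proof -
  interpret A: ring "quat_alg a b" by (rule ring_quat_alg)
  let ?K = "quat_scalar ring_of_type_algebra ` carrier (ring_of_integers :: 'k ring)"
  have scale: "quat_mult ring_of_type_algebra a b (quat_scalar ring_of_type_algebra c) u = quad_scale c u" for c
    by (cases u) (simp add: quat_scalar_def quad_scale_def)
  have eq: "span_R a b (u # us) = A.line_extension ?K u (span_R a b us)"
    unfolding span_R_def by simp
  show ?thesis
    unfolding eq A.line_extension_mem_iff by (simp add: scale Bex_def del: split_paired_Ex)
qed

lemma standard_order_eq: "standard_order a b = (integral_quad :: 'k::field_char_0 quad set)"
proof -
  have "x \<in> standard_order a b \<longleftrightarrow> (\<exists>c0 c1 c2 c3. algebraic_int c0 \<and> algebraic_int c1 \<and> algebraic_int c2 \<and>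
      algebraic_int c3 \<and> x = (c0, c1, c2, c3))" for x
    by (auto simp: standard_order_def span_R_Cons span_R_Nil quad_scale_def quat_i_def quat_j_def)
  then show ?thesis by (auto simp: integral_quad_def)
qed

context class_number_one
begin

lemma common_denominator:
  fixes u :: "'k quad"
  obtains d where "d \<noteq> 0" "algebraic_int d" "quad_scale d u \<in> integral_quad"
proof -
  obtain u0 u1 u2 u3 where u: "u = (u0, u1, u2, u3)" by (cases u)
  obtain d0 where d0: "d0 \<noteq> 0" "algebraic_int d0" "algebraic_int (d0 * u0)" using fraction .
  obtain d1 where d1: "d1 \<noteq> 0" "algebraic_int d1" "algebraic_int (d1 * u1)" using fraction .
  obtain d2 where d2: "d2 \<noteq> 0" "algebraic_int d2" "algebraic_int (d2 * u2)" using fraction .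
  obtain d3 where d3: "d3 \<noteq> 0" "algebraic_int d3" "algebraic_int (d3 * u3)" using fraction .
  let ?d = "d0 * d1 * d2 * d3"
  note mult3 = algebraic_int_mult[OF algebraic_int_mult[OF algebraic_int_mult]]
  have "algebraic_int (?d * u0)" "algebraic_int (?d * u1)" "algebraic_int (?d * u2)" "algebraic_int (?d * u3)"
    using mult3[OF d1(2) d2(2) d3(2) d0(3)] mult3[OF d0(2) d2(2) d3(2) d1(3)]
      mult3[OF d0(2) d1(2) d3(2) d2(3)] mult3[OF d0(2) d1(2) d2(2) d3(3)]
    by (simp_all add: mult_ac)
  then have "quad_scale ?d u \<in> integral_quad"
    by (simp add: u quad_scale_def integral_quad_def)
  then show thesis using that[of ?d] d0 d1 d2 d3 by (simp add: algebraic_int_mult)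
qed

text \<open>
  The product of denominators of the generators is a denominator of their span.
\<close>

lemma lattice_bounded:
  fixes a b :: 'k
  obtains d where "d \<noteq> 0" "algebraic_int d" "\<And>x. x \<in> span_R a b us \<Longrightarrow> quad_scale d x \<in> integral_quad"
proof -
  have "\<exists>d. d \<noteq> 0 \<and> algebraic_int d \<and> (\<forall>x\<in>span_R a b us. quad_scale d x \<in> integral_quad)"
  proof (induction us)
    case Nil
    then show ?case
      by (intro exI[of _ 1]) (simp add: span_R_Nil quad_scale_def integral_quad_def)
  next
    case (Cons u us)
    then obtain d where d: "d \<noteq> 0" "algebraic_int d" "\<And>x. x \<in> span_R a b us \<Longrightarrow> quad_scale d x \<in> integral_quad"
      by blast
    obtain e where e: "e \<noteq> 0" "algebraic_int e" "quad_scale e u \<in> integral_quad"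
      using common_denominator .
    have "quad_scale (d * e) x \<in> integral_quad" if x: "x \<in> span_R a b (u # us)" for x
    proof -
      obtain c v where cv: "algebraic_int c" "v \<in> span_R a b us"
        "x = quat_add ring_of_type_algebra (quad_scale c u) v"
        using x unfolding span_R_Cons by blast
      obtain u0 u1 u2 u3 where u: "u = (u0, u1, u2, u3)" by (cases u)
      obtain v0 v1 v2 v3 where v: "v = (v0, v1, v2, v3)" by (cases v)
      have eu: "algebraic_int (e * u0)" "algebraic_int (e * u1)" "algebraic_int (e * u2)" "algebraic_int (e * u3)"
        using e(3) by (simp_all add: u quad_scale_def integral_quad_def)
      have dv: "algebraic_int (d * v0)" "algebraic_int (d * v1)" "algebraic_int (d * v2)" "algebraic_int (d * v3)"
        using d(3)[OF cv(2)] by (simp_all add: v quad_scale_def integral_quad_def)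
      have split: "d * e * (c * s + t) = (d * c) * (e * s) + e * (d * t)" for s t
        by (simp add: algebra_simps)
      have "algebraic_int (d * e * (c * s + t))" if "algebraic_int (e * s)" "algebraic_int (d * t)" for s t
        unfolding split
        by (rule algebraic_int_add[OF
            algebraic_int_mult[OF algebraic_int_mult[OF d(2) cv(1)] that(1)] algebraic_int_mult[OF e(2) that(2)]])
      then show ?thesis
        using eu dv by (simp add: cv(3) u v quad_scale_def integral_quad_def)
    qed
    then show ?case using d e algebraic_int_mult by (intro exI[of _ "d * e"]) simp
  qed
  then show thesis using that by blast
qed

text \<open>
  Norms of elements of the lattice have bounded denominators.  This applies to all powers of \<open>x\<close>, so
  the powers of the norm of \<open>x\<close> have bounded denominators.
\<close>

lemma order_norm_integral:
  fixes a b :: 'k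
  assumes ab: "algebraic_int a" "algebraic_int b"
    and M: "quat_order a b M" and x: "x \<in> M"
  shows "algebraic_int (quat_norm a b x)"
proof -
  obtain us where us: "M = span_R a b us" and sub: "subring M (quat_alg a b)"
    using M by (auto simp: quat_order_def complete_R_lattice_def)
  obtain d where d: "d \<noteq> 0" "algebraic_int d" "\<And>y. y \<in> M \<Longrightarrow> quad_scale d y \<in> integral_quad"
    using lattice_bounded[of a b us] us by blast
  have norm: "algebraic_int (d * d * quat_norm a b y)" if "y \<in> M" for y
  proof -
    obtain y0 y1 y2 y3 where y: "y = (y0, y1, y2, y3)" by (cases y)
    have int: "algebraic_int (d * y0)" "algebraic_int (d * y1)" "algebraic_int (d * y2)" "algebraic_int (d * y3)"
      using d(3)[OF that] by (simp_all add: y quad_scale_def integral_quad_def)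
    have "d * d * quat_norm a b y = (d * y0) * (d * y0) - a * ((d * y1) * (d * y1))
        - b * ((d * y2) * (d * y2)) + (a * b) * ((d * y3) * (d * y3))"
      by (simp add: y quat_norm_def algebra_simps)
    also have "algebraic_int \<dots>"
      by (intro algebraic_int_add algebraic_int_diff algebraic_int_mult int ab)
    finally show ?thesis .
  qed
  have pow: "\<exists>y\<in>M. quat_norm a b y = quat_norm a b x ^ n" for n
  proof (induction n)
    case 0
    show ?case using subringE(3)[OF sub] by (intro bexI[of _ "(1, 0, 0, 0)"]) (simp_all add: quat_norm_def)
  next
    case (Suc n)
    then obtain y where y: "y \<in> M" "quat_norm a b y = quat_norm a b x ^ n" by blast
    then show ?case
      using subringE(6)[OF sub x y(1)]
      by (intro bexI[of _ "quat_mult ring_of_type_algebra a b x y"]) (simp_all add: quat_norm_mult)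
  qed
  show ?thesis
  proof (rule completely_integrally_closed[of "d * d"])
    show "algebraic_int (d * d * quat_norm a b x ^ n)" for n using pow[of n] norm by metis
  qed (use d in \<open>auto intro: algebraic_int_mult\<close>)
qed

lemma order_trace_integral:
  fixes a b :: 'k
  assumes ab: "algebraic_int a" "algebraic_int b"
    and M: "quat_order a b M" and x: "(x0, x1, x2, x3) \<in> M"
  shows "algebraic_int (2 * x0)"
proof -
  have sub: "subring M (quat_alg a b)" using M by (simp add: quat_order_def)
  have "quat_add ring_of_type_algebra (x0, x1, x2, x3) (1, 0, 0, 0) \<in> M"
    using subringE(7)[OF sub x subringE(3)[OF sub]] by simp
  then have "algebraic_int (quat_norm a b (x0 + 1, x1, x2, x3))"
    using order_norm_integral[OF ab M] by simp
  then have "algebraic_int (quat_norm a b (x0 + 1, x1, x2, x3) - quat_norm a b (x0, x1, x2, x3) - 1)"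
    using order_norm_integral[OF ab M x] by (intro algebraic_int_diff) auto
  then show ?thesis by (simp add: quat_norm_def algebra_simps)
qed

end

section \<open>The coordinates of a maximal order\<close>

context prime_with_generator
begin

lemma squarefree_valuation:
  assumes sf: "squarefree_elt \<R> m" and m: "algebraic_int m"
  obtains w where "algebraic_int w" "w \<notin> P" "m = w \<or> m = p * w"
proof (cases "m \<in> P")
  case False
  then show thesis using that m by blast
next
  case True
  then obtain w where w: "algebraic_int w" "m = p * w" by (auto simp: mem_P_iff)
  interpret M: Group.comm_monoid "ideals_set \<R>" by (rule R.ideals_set_is_comm_monoid)
  have "P [^]\<^bsub>ideals_set \<R>\<^esub> (2::nat) \<in> carrier (ideals_set \<R>)"
    by (rule M.nat_pow_closed) (simp add: ideals_set_def PI.ideal_axioms)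
  then have "ideal (P [^]\<^bsub>ideals_set \<R>\<^esub> (2::nat)) \<R>" by (simp add: ideals_set_def)
  then have "m \<notin> P [^]\<^bsub>ideals_set \<R>\<^esub> (2::nat)"
    using sf prime divides_principal_iff[OF _ m] unfolding squarefree_elt_def by blast
  then have "w \<notin> P"
    unfolding ideal_power w(2) by (auto simp: mem_P_iff power2_eq_square mult.assoc)
  then show thesis using that w by blast
qed

lemma squarefree_nonzero:
  assumes "squarefree_elt \<R> m" "algebraic_int m"
  shows "m \<noteq> 0"
  using squarefree_valuation[OF assms] p_nonzero zero_in_P by (metis mult_eq_0_iff)

lemma generator_over_divisor_in_L:
  assumes sf: "squarefree_elt \<R> (d * c)" and d: "algebraic_int d" and c: "algebraic_int c"
  shows "p / d \<in> L"
proof -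
  have dc: "algebraic_int (d * c)" using algebraic_int_mult d c .
  obtain w where w: "algebraic_int w" "w \<notin> P" "d * c = w \<or> d * c = p * w"
    using squarefree_valuation[OF sf dc] .
  have nz: "d \<noteq> 0" "c \<noteq> 0" using squarefree_nonzero[OF sf dc] by auto
  have eq: "p / d = p * c / (d * c)" using nz by simp
  from w(3) show ?thesis
  proof
    assume "d * c = w"
    then have "p / d = p * c / w" using eq by (simp only:)
    then show ?thesis by (rule local_ringI[OF algebraic_int_mult[OF p_int c] w(1,2)])
  next
    assume "d * c = p * w"
    then have "p / d = p * c / (p * w)" using eq by (simp only:)
    also have "\<dots> = c / w" using p_nonzero by simp
    finally show ?thesis by (rule local_ringI[OF c w(1,2)])
  qed
qed

text \<open>
  The trace criterion is applied to the element and to its products with the inverses of \<open>i\<close>, \<open>j\<close> and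
  \<open>ij\<close>, which are used up to signs of coordinates: the norm form does not see them.
\<close>

lemma ramified_order_coordinates:
  assumes ram: "P \<in> Ram_f a b" and a: "algebraic_int a" and b: "algebraic_int b"
    and sf: "squarefree_elt \<R> (a * b)"
    and norm: "algebraic_int (quat_norm a b (x0, x1, x2, x3))"
  shows "2 * x0 \<in> L" "2 * x1 \<in> L" "2 * x2 \<in> L" "2 * x3 \<in> L"
proof -
  let ?N = "quat_norm a b (x0, x1, x2, x3)"
  have ab0: "a \<noteq> 0" "b \<noteq> 0"
    using squarefree_nonzero[OF sf algebraic_int_mult[OF a b]] by auto
  have NL: "?N \<in> L" using norm by (rule int_in_L)
  have pa: "p / a \<in> L" using generator_over_divisor_in_L[OF sf a b] .
  have pb: "p / b \<in> L" using generator_over_divisor_in_L[of b a] sf a b by (simp add: mult.commute)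
  have pab: "p / (a * b) \<in> L"
    using generator_over_divisor_in_L[of "a * b" 1] sf algebraic_int_mult[OF a b] by simp
  show "2 * x0 \<in> L"
    by (rule ramified_trace_integral[OF ram L_mult[OF p_in_L NL]])
  have "quat_norm a b (x1, x0 / a, x3, x2 / a) = - (?N / a)"
    using ab0 by (simp add: quat_norm_def field_simps)
  then have "p * quat_norm a b (x1, x0 / a, x3, x2 / a) = - (p / a * ?N)" by simp
  then show "2 * x1 \<in> L"
    using ramified_trace_integral[OF ram] L_minus[OF L_mult[OF pa NL]] by metis
  have "quat_norm a b (x2, x3, x0 / b, x1 / b) = - (?N / b)"
    using ab0 by (simp add: quat_norm_def field_simps)
  then have "p * quat_norm a b (x2, x3, x0 / b, x1 / b) = - (p / b * ?N)" by simp
  then show "2 * x2 \<in> L"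
    using ramified_trace_integral[OF ram] L_minus[OF L_mult[OF pb NL]] by metis
  have "quat_norm a b (x3, x2 / a, x1 / b, x0 / (a * b)) = ?N / (a * b)"
    using ab0 by (simp add: quat_norm_def field_simps)
  then have "p * quat_norm a b (x3, x2 / a, x1 / b, x0 / (a * b)) = p / (a * b) * ?N" by simp
  then show "2 * x3 \<in> L"
    using ramified_trace_integral[OF ram] L_mult[OF pab NL] by metis
qed

end

context class_number_one
begin

text \<open>
  The coordinates are, up to the factors \<open>a\<close>, \<open>b\<close> and \<open>- ab\<close>, the halved traces of the products with
  \<open>1, i, j, ij\<close>.
\<close>

lemma order_coordinates_times_ab:
  fixes a b :: 'k
  assumes a: "algebraic_int a" and b: "algebraic_int b" and M: "quat_order a b M"
    and std: "standard_order a b \<subseteq> M" and x: "(x0, x1, x2, x3) \<in> M"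
  shows "algebraic_int (a * b * (2 * x0))" "algebraic_int (a * b * (2 * x1))"
    "algebraic_int (a * b * (2 * x2))" "algebraic_int (a * b * (2 * x3))"
proof -
  have sub: "subring M (quat_alg a b)" using M by (simp add: quat_order_def)
  note trace = order_trace_integral[OF a b M]
  have prod: "quat_mult ring_of_type_algebra a b e (x0, x1, x2, x3) \<in> M" if "e \<in> integral_quad" for e
    using subringE(6)[OF sub _ x, of e] that std by (auto simp: standard_order_eq)
  have t0: "algebraic_int (2 * x0)" using trace[OF x] .
  have t1: "algebraic_int (2 * (a * x1))"
    using prod[of "(0, 1, 0, 0)"] by (intro trace) (simp add: integral_quad_def)
  have t2: "algebraic_int (2 * (b * x2))"
    using prod[of "(0, 0, 1, 0)"] by (intro trace) (simp add: integral_quad_def)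
  have t3: "algebraic_int (2 * - (a * b * x3))"
    using prod[of "(0, 0, 0, 1)"] by (intro trace) (simp add: integral_quad_def)
  show "algebraic_int (a * b * (2 * x0))" by (intro algebraic_int_mult a b t0)
  show "algebraic_int (a * b * (2 * x1))" using algebraic_int_mult[OF b t1] by (simp add: mult_ac)
  show "algebraic_int (a * b * (2 * x2))" using algebraic_int_mult[OF a t2] by (simp add: mult_ac)
  show "algebraic_int (a * b * (2 * x3))" using algebraic_int_minus[OF t3] by (simp add: mult_ac)
qed

end

theorem proposition5p1:
  fixes a b r :: "'k::field_char_0" and \<beta> :: "'k quad"
    and \<pi> :: "'k set \<Rightarrow> 'k" and R :: "'k ring" and \<O> \<O>' :: "'k quad set"
  assumes "number_field TYPE('k)"
    and "R = ring_of_integers"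
    and "class_number R = 1"
    and "a \<in> carrier R" and "b \<in> carrier R"
    and "squarefree_elt R (a * b)"
    and "quat_disc a b divides\<^bsub>ideals_set R\<^esub> PIdl\<^bsub>R\<^esub> (a * b)"
    and "\<And>P. P \<in> prime_ideals R \<Longrightarrow> P \<notin> Ram_f a b \<Longrightarrow> \<pi> P \<in> carrier R \<and> PIdl\<^bsub>R\<^esub> (\<pi> P) = P"
    and "r = (if quat_disc a b = PIdl\<^bsub>R\<^esub> (a * b) then 1
              else \<Prod>P \<in> {P \<in> prime_ideals R. P divides\<^bsub>ideals_set R\<^esub> PIdl\<^bsub>R\<^esub> (a * b) \<and>
                                    \<not> P divides\<^bsub>ideals_set R\<^esub> quat_disc a b}. \<pi> P)"
    and "\<O>' = standard_order a b"
    and "\<beta> \<in> carrier (quat_alg a b)"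
    and "\<O> = generate_ring (quat_alg a b) (\<O>' \<union> {\<beta>})"
    and "maximal_order a b \<O>"
  shows "\<beta> \<in> quat_scalar ring_of_type_algebra (1 / (2 * r)) <#\<^bsub>quat_alg a b\<^esub> \<O>'"
proof -
  interpret class_number_one "TYPE('k)"
    using assms(1-3) by unfold_locales auto
  have R: "R = \<R>" by (fact assms(2))
  have a: "algebraic_int a" and b: "algebraic_int b" using assms(4,5) by (simp_all add: R)
  have ab: "algebraic_int (a * b)" using algebraic_int_mult[OF a b] .
  have sf: "squarefree_elt \<R> (a * b)" using assms(6) by (simp add: R)
  define S where "S = {P \<in> prime_ideals \<R>. P divides\<^bsub>ideals_set \<R>\<^esub> PIdl\<^bsub>\<R>\<^esub> (a * b) \<and>
    \<not> P divides\<^bsub>ideals_set \<R>\<^esub> quat_disc a b}"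
  have r: "r = (if quat_disc a b = PIdl\<^bsub>\<R>\<^esub> (a * b) then 1 else \<Prod>P\<in>S. \<pi> P)"
    using assms(9) by (simp add: R S_def)
  \<comment> \<open>0 is divisible by the square of any prime.\<close>
  have ab0: "a * b \<noteq> 0" if "P \<in> prime_ideals \<R>" for P
    using prime_ideal_with_generator[OF that] prime_with_generator.squarefree_nonzero[OF _ sf ab] by metis
  have fin: "finite (Ram_f a b)"
  proof (cases "Ram_f a b = {}")
    case False
    then obtain P where "P \<in> prime_ideals \<R>" by (auto simp: Ram_f_def)
    then show ?thesis using finite_Ram_f[OF a b ab0] by blast
  qed simp
  have finS: "finite S"
  proof (cases "S = {}")
    case False
    then obtain P where P: "P \<in> prime_ideals \<R>" by (auto simp: S_def)
    have "S \<subseteq> {P \<in> prime_ideals \<R>. a * b \<in> P}"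
      using divides_principal_iff[OF _ ab] by (auto simp: S_def prime_ideals_def primeideal_def)
    then show ?thesis using finite_primes_containing[OF ab ab0[OF P]] finite_subset by blast
  qed simp
  have gen: "algebraic_int (\<pi> P) \<and> PIdl\<^bsub>\<R>\<^esub> (\<pi> P) = P" if "P \<in> S" for P
    using assms(8)[of P] that divides_quat_disc_iff[OF fin] by (auto simp: R S_def)
  have r_int: "algebraic_int r" using gen by (auto simp: r intro!: algebraic_int_prod)
  have r0: "r \<noteq> 0"
    using gen principal_generator_nonzero finS by (auto simp: r S_def)
  have order: "quat_order a b \<O>" using assms(13) by (simp add: maximal_order_def)
  have std: "standard_order a b \<subseteq> \<O>" and \<beta>: "\<beta> \<in> \<O>"
    using assms(10,12) by (auto intro: generate_ring.incl)
  obtain x0 x1 x2 x3 where x: "\<beta> = (x0, x1, x2, x3)" by (cases \<beta>)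
  have norm: "algebraic_int (quat_norm a b (x0, x1, x2, x3))"
    using order_norm_integral[OF a b order \<beta>] by (simp add: x)
  note ab_int = order_coordinates_times_ab[OF a b order std \<beta>[unfolded x]]
  have integral: "algebraic_int (r * y)"
    if y: "algebraic_int (a * b * y)" "y \<in> {2 * x0, 2 * x1, 2 * x2, 2 * x3}" for y
  proof (rule local_global_integral)
    fix P assume P: "P \<in> prime_ideals \<R>"
    obtain p where p: "prime_with_generator P p" using prime_ideal_with_generator[OF P] .
    have P_ideal: "ideal P \<R>" using P by (simp add: prime_ideals_def primeideal_def)
    note nz = ab0[OF P]
    consider "P \<in> Ram_f a b" | "P \<notin> Ram_f a b" "a * b \<notin> P" | "P \<notin> Ram_f a b" "a * b \<in> P"
      by blast
    then show "r * y \<in> local_ring P"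
    proof cases
      case 1
      interpret prime_with_generator "TYPE('k)" P p by (rule p)
      have "y \<in> L" using y(2) ramified_order_coordinates[OF 1 a b sf norm] by blast
      then show ?thesis using L_mult[OF int_in_L[OF r_int]] by blast
    next
      case 2
      have "algebraic_int (r * (a * b * y))" using algebraic_int_mult[OF r_int y(1)] .
      then show ?thesis
        using prime_with_generator.local_ringI[OF p _ ab 2(2), of "r * (a * b * y)" "r * y"] nz by simp
    next
      case 3
      have notdiv: "\<not> P divides\<^bsub>ideals_set \<R>\<^esub> quat_disc a b"
        using divides_quat_disc_iff[OF fin P] 3(1) by blast
      have div: "P divides\<^bsub>ideals_set \<R>\<^esub> PIdl\<^bsub>\<R>\<^esub> (a * b)"
        using divides_principal_iff[OF P_ideal ab] 3(2) by blast
      have PS: "P \<in> S" using P div notdiv by (simp add: S_def)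
      \<comment> \<open>If \<open>\<Delta>(A)\<close> were the ideal generated by \<open>ab\<close>, the prime \<open>P\<close> would divide it.\<close>
      have "r = (\<Prod>P\<in>S. \<pi> P)" using r div notdiv by auto
      then have r_split: "r = \<pi> P * (\<Prod>Q\<in>S - {P}. \<pi> Q)" using prod.remove[OF finS PS] by simp
      have rest: "algebraic_int (\<Prod>Q\<in>S - {P}. \<pi> Q)" using gen by (intro algebraic_int_prod) auto
      interpret prime_with_generator "TYPE('k)" P "\<pi> P"
        by unfold_locales (use P gen[OF PS] in auto)
      obtain w where w: "algebraic_int w" "w \<notin> P" "a * b = w \<or> a * b = \<pi> P * w"
        using squarefree_valuation[OF sf ab] .
      then have abw: "a * b = \<pi> P * w" using 3(2) by blast
      have "r * y = (\<Prod>Q\<in>S - {P}. \<pi> Q) * (a * b * y) / w"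
        using w(2) not_in_P_nonzero by (simp add: r_split abw)
      then show ?thesis
        using local_ringI[OF algebraic_int_mult[OF rest y(1)] w(1,2)] by simp
    qed
  qed
  define h where "h = (r * (2 * x0), r * (2 * x1), r * (2 * x2), r * (2 * x3))"
  have "h \<in> \<O>'"
    unfolding assms(10) standard_order_eq using ab_int by (simp add: h_def integral_quad_def integral)
  moreover have "\<beta> = quat_scalar ring_of_type_algebra (1 / (2 * r)) \<otimes>\<^bsub>quat_alg a b\<^esub> h"
    using r0 by (simp add: x h_def quat_scalar_def)
  ultimately show ?thesis unfolding l_coset_def by blast
qed

end
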